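(* Let $\alpha,\beta$ be reals. Then: (1) if $\alpha\le_{\mathrm S}\beta$, then $\alpha\le_{\mathrm{cl}}^{\mathrm{open}}\beta$; (2) if $\alpha\le_{\mathrm S}^{\mathrm{tot}}\beta$, then $\alpha\le_{\mathrm{cl}}^{\mathrm{local}}\beta$; (3) if moreover $\alpha$ is not computable, then $\alpha\le_{\mathrm S}\beta$ implies $\alpha\le_{\mathrm S}^{\mathbb R}\beta$.
   Context: Reals are taken in $[0,1)$ unless stated otherwise. The left cut of $\beta$ is $\mathrm{LC}(\beta)=\{y\in\mathbb Q: 0\le y<\beta\}$. A $\mathbb Q$-translation function from $\beta$ to $\alpha$ is a partial computable function $g$ from $\mathbb Q\cap[0,1)$ to itself such that for every $q\in\mathrm{LC}(\beta)$, $g(q)$ is defined and $g(q)<\alpha$, and $\lim_{q\nearrow\beta}g(q)=\alpha$ (left limit over rationals). $\alpha\le_{\mathrm S}\beta$ (Solovay reducibility) means there are a real constant $c$ and a $\mathbb Q$-translation function $g$ from $\beta$ to $\alpha$ with $\alpha-g(q)<c(\beta-q)$ for all rationals $q<\beta$. $\alpha\le_{\mathrm S}^{\mathrm{tot}}\beta$ (total Solovay reducibility) means $\alpha\le_{\mathrm S}\beta$ via a $\mathbb Q$-translation function that is total computable on $\mathbb Q\cap[0,1)$. A sequence of rationals $(q_n)$ is an effective approximation (of its limit $x$) if $|q_n-q_{n+1}|<2^{-n}$ for all $n$. A real function $f$ is computable on a set $X$ if there is an oracle Turing machine which, for every $x\in X$ and every effective approximation of $x$ given as oracle, outputs an effective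 approximation of $f(x)$. A function $f$ is Lipschitz continuous if there is $d$ with $|f(x)-f(y)|\le d|x-y|$ for all $x,y$ in its domain. An $\mathbb R$-translation function from $\beta$ to $\alpha$ is a real function computable on $[0,\beta)$, mapping $[0,\beta)$ into $[0,\alpha)$, with $\lim_{x\nearrow\beta}f(x)=\alpha$. $\alpha\le_{\mathrm S}^{\mathbb R}\beta$ (real Solovay reducibility) means there is a Lipschitz continuous $\mathbb R$-translation function from $\beta$ to $\alpha$. A weakly $\mathbb R$-translation function from $\beta$ to $\alpha$ is a real function computable on $[0,\beta)$ with $\lim_{x\nearrow\beta}f(x)=\alpha$ (no requirement $f(x)<\alpha$). $\alpha\le_{\mathrm{cl}}^{\mathrm{open}}\beta$ means there is a Lipschitz continuous weakly $\mathbb R$-translation function from $\beta$ to $\alpha$. $\alpha\le_{\mathrm{cl}}^{\mathrm{local}}\beta$ means there are a real $b>\beta$ and a Lipschitz continuous real function $f$ computable on $[0,b]$ with $f(\beta)=\alpha$. *)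

theory Defs
  imports "HOL-Analysis.Analysis" "HOL-Library.Nat_Bijection"
begin

text \<open>
  Oracle computation is modelled by Kleene's partial recursive functionals, that is, the
  mu-recursive functions extended by an initial function that queries the oracle.  They
  are the functionals computed by oracle Turing machines.
\<close>

datatype prog =
    Zero
  | Succ
  | Proj nat
  | Query
  | Comp prog "prog list"
  | PrimRec prog prog
  | Mu prog

text \<open>\<open>evals A p xs v\<close>: the program \<open>p\<close> with oracle \<open>A\<close> halts on \<open>xs\<close> with output \<open>v\<close>.\<close>

inductive evals :: "(nat \<Rightarrow> nat) \<Rightarrow> prog \<Rightarrow> nat list \<Rightarrow> nat \<Rightarrow> bool" for A where
  evals_Zero: "evals A Zero xs 0"
| evals_Succ: "evals A Succ [x] (Suc x)"
| evals_Proj: "i < length xs \<Longrightarrow> evals A (Proj i) xs (xs ! i)"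
| evals_Query: "evals A Query [x] (A x)"
| evals_Comp: "list_all2 (\<lambda>q y. evals A q xs y) qs ys \<Longrightarrow> evals A p ys v
    \<Longrightarrow> evals A (Comp p qs) xs v"
| evals_PrimRec_0: "evals A p xs v \<Longrightarrow> evals A (PrimRec p q) (0 # xs) v"
| evals_PrimRec_Suc: "evals A (PrimRec p q) (n # xs) u \<Longrightarrow> evals A q (n # u # xs) v
    \<Longrightarrow> evals A (PrimRec p q) (Suc n # xs) v"
| evals_Mu: "evals A p (n # xs) 0 \<Longrightarrow> (\<And>m. m < n \<Longrightarrow> \<exists>u>0. evals A p (m # xs) u)
    \<Longrightarrow> evals A (Mu p) xs n"

inductive_cases evals_CompE: "evals A (Comp p qs) xs v"
inductive_cases evals_MuE: "evals A (Mu p) xs v"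

lemma evals_deterministic: "evals A p xs v \<Longrightarrow> evals A p xs w \<Longrightarrow> v = w"
proof (induction p xs v arbitrary: w rule: evals.induct)
  case (evals_Zero xs)
  then show ?case by (cases rule: evals.cases) auto
next
  case (evals_Succ x)
  then show ?case by (cases rule: evals.cases) auto
next
  case (evals_Proj i xs)
  from evals_Proj.prems show ?case by (cases rule: evals.cases) auto
next
  case (evals_Query x)
  then show ?case by (cases rule: evals.cases) auto
next
  case (evals_Comp xs qs ys p v)
  from evals_Comp.prems obtain zs where
    zs: "list_all2 (\<lambda>q y. evals A q xs y) qs zs" and w: "evals A p zs w"
    by (rule evals_CompE)
  have "ys = zs"
  proof (rule nth_equalityI)
    show "length ys = length zs"
      using evals_Comp.IH(1) zs by (simp add: list_all2_conv_all_nth)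
    show "ys ! i = zs ! i" if "i < length ys" for i
      using evals_Comp.IH(1) zs that by (simp add: list_all2_conv_all_nth)
  qed
  with evals_Comp.IH(2) w show ?case by blast
next
  case (evals_PrimRec_0 p xs v q)
  from evals_PrimRec_0.prems have "evals A p xs w" by (cases rule: evals.cases)
  then show ?case by (rule evals_PrimRec_0.IH)
next
  case (evals_PrimRec_Suc p q n xs u v)
  from evals_PrimRec_Suc.prems obtain u' where
    "evals A (PrimRec p q) (n # xs) u'" and w: "evals A q (n # u' # xs) w"
    by (cases rule: evals.cases)
  then have "u = u'" by (intro evals_PrimRec_Suc.IH(1))
  with w show ?case by (intro evals_PrimRec_Suc.IH(2)) simp
next
  case (evals_Mu p n xs)
  from evals_Mu.prems have w: "evals A p (w # xs) 0"
      and below: "\<And>m. m < w \<Longrightarrow> \<exists>u>0. evals A p (m # xs) u"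
    by (rule evals_MuE, blast)+
  show ?case
  proof (rule linorder_cases[of n w])
    assume "n < w"
    then obtain u where "u > 0" "evals A p (n # xs) u" using below by blast
    then show ?thesis using evals_Mu.IH(1) by blast
  next
    assume "w < n"
    then obtain u where "u > 0" "\<forall>v. evals A p (w # xs) v \<longrightarrow> u = v"
      using evals_Mu.IH(2) by blast
    then show ?thesis using w by blast
  qed
qed

text \<open>Rationals are presented to programs in lowest terms with positive denominator.\<close>

definition rat_code :: "rat \<Rightarrow> nat" where
  "rat_code q = (case quotient_of q of (a, b) \<Rightarrow> prod_encode (int_encode a, nat b))"

text \<open>Computation without an oracle is computation with the constant oracle zero.\<close>

abbreviation no_oracle :: "nat \<Rightarrow> nat" where
  "no_oracle \<equiv> (\<lambda>_. 0)"

text \<open>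
  Partial computable functions from the rationals in \<open>[0,1)\<close> to themselves.  The program
  must diverge at those arguments in \<open>[0,1)\<close> at which the function is undefined.
\<close>

definition partial_computable :: "(rat \<Rightarrow> rat option) \<Rightarrow> bool" where
  "partial_computable g \<longleftrightarrow> dom g \<subseteq> {0..<1} \<and> ran g \<subseteq> {0..<1} \<and>
     (\<exists>p. \<forall>q\<in>{0..<1}. \<forall>v. evals no_oracle p [rat_code q] v \<longleftrightarrow>
        (\<exists>r. g q = Some r \<and> v = rat_code r))"

definition effective_approx :: "(nat \<Rightarrow> rat) \<Rightarrow> real \<Rightarrow> bool" where
  "effective_approx q x \<longleftrightarrow> (\<forall>n. \<bar>q n - q (Suc n)\<bar> < 1 / 2 ^ n) \<and>
     (\<lambda>n. real_of_rat (q n)) \<longlonglongrightarrow> x"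

definition computable_real :: "real \<Rightarrow> bool" where
  "computable_real x \<longleftrightarrow>
     (\<exists>p q. effective_approx q x \<and> (\<forall>n. evals no_oracle p [n] (rat_code (q n))))"

definition computable_on :: "real set \<Rightarrow> (real \<Rightarrow> real) \<Rightarrow> bool" where
  "computable_on X f \<longleftrightarrow>
     (\<exists>p. \<forall>x\<in>X. \<forall>q. effective_approx q x \<longrightarrow>
        (\<exists>r. effective_approx r (f x) \<and>
             (\<forall>n. evals (\<lambda>k. rat_code (q k)) p [n] (rat_code (r n)))))"

definition lipschitz_continuous_on :: "real set \<Rightarrow> (real \<Rightarrow> real) \<Rightarrow> bool" where
  "lipschitz_continuous_on X f \<longleftrightarrow> (\<exists>d. d-lipschitz_on X f)"

definition left_cut :: "real \<Rightarrow> rat set" where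
  "left_cut \<beta> = {y. 0 \<le> y \<and> real_of_rat y < \<beta>}"

text \<open>
  A limit is asserted only where it makes sense, i.e. at a limit point of the domain;
  \<open>tendsto\<close> alone would hold vacuously for the left limit at \<open>0\<close> of a function on \<open>[0,1)\<close>.
  Accordingly no function is a translation function from \<open>0\<close>.
\<close>

definition has_limit :: "('a \<Rightarrow> real) \<Rightarrow> real \<Rightarrow> 'a filter \<Rightarrow> bool" where
  "has_limit f l F \<longleftrightarrow> F \<noteq> bot \<and> (f \<longlongrightarrow> l) F"

definition left_rats :: "real \<Rightarrow> rat filter" where
  "left_rats \<beta> = filtercomap real_of_rat (at \<beta> within real_of_rat ` left_cut \<beta>)"

definition rat_translation :: "real \<Rightarrow> real \<Rightarrow> (rat \<Rightarrow> rat option) \<Rightarrow> bool" where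
  "rat_translation \<beta> \<alpha> g \<longleftrightarrow> partial_computable g \<and>
     (\<forall>q\<in>left_cut \<beta>. \<exists>r. g q = Some r \<and> real_of_rat r < \<alpha>) \<and>
     has_limit (\<lambda>q. real_of_rat (the (g q))) \<alpha> (left_rats \<beta>)"

definition solovay_via :: "(rat \<Rightarrow> rat option) \<Rightarrow> real \<Rightarrow> real \<Rightarrow> bool" where
  "solovay_via g \<alpha> \<beta> \<longleftrightarrow> rat_translation \<beta> \<alpha> g \<and>
     (\<exists>c::real. \<forall>q\<in>left_cut \<beta>. \<alpha> - real_of_rat (the (g q)) < c * (\<beta> - real_of_rat q))"

definition solovay_le :: "real \<Rightarrow> real \<Rightarrow> bool" (infix "\<le>\<^sub>S" 50) where
  "\<alpha> \<le>\<^sub>S \<beta> \<longleftrightarrow> (\<exists>g. solovay_via g \<alpha> \<beta>)"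

definition total_solovay_le :: "real \<Rightarrow> real \<Rightarrow> bool" (infix "\<le>\<^sub>S\<^sup>t\<^sup>o\<^sup>t" 50) where
  "\<alpha> \<le>\<^sub>S\<^sup>t\<^sup>o\<^sup>t \<beta> \<longleftrightarrow> (\<exists>g. dom g = {0..<1} \<and> solovay_via g \<alpha> \<beta>)"

definition weakly_real_translation :: "real \<Rightarrow> real \<Rightarrow> (real \<Rightarrow> real) \<Rightarrow> bool" where
  "weakly_real_translation \<beta> \<alpha> f \<longleftrightarrow>
     computable_on {0..<\<beta>} f \<and> has_limit f \<alpha> (at \<beta> within {0..<\<beta>})"

definition real_translation :: "real \<Rightarrow> real \<Rightarrow> (real \<Rightarrow> real) \<Rightarrow> bool" where
  "real_translation \<beta> \<alpha> f \<longleftrightarrow>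
     computable_on {0..<\<beta>} f \<and> f ` {0..<\<beta>} \<subseteq> {0..<\<alpha>} \<and>
     has_limit f \<alpha> (at \<beta> within {0..<\<beta>})"

definition real_solovay_le :: "real \<Rightarrow> real \<Rightarrow> bool" (infix "\<le>\<^sub>S\<^sup>\<real>" 50) where
  "\<alpha> \<le>\<^sub>S\<^sup>\<real> \<beta> \<longleftrightarrow> (\<exists>f. lipschitz_continuous_on {0..<\<beta>} f \<and> real_translation \<beta> \<alpha> f)"

definition cl_open_le :: "real \<Rightarrow> real \<Rightarrow> bool" (infix "\<le>\<^sub>c\<^sub>l\<^sup>o\<^sup>p\<^sup>e\<^sup>n" 50) where
  "\<alpha> \<le>\<^sub>c\<^sub>l\<^sup>o\<^sup>p\<^sup>e\<^sup>n \<beta> \<longleftrightarrow>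
     (\<exists>f. lipschitz_continuous_on {0..<\<beta>} f \<and> weakly_real_translation \<beta> \<alpha> f)"

definition cl_local_le :: "real \<Rightarrow> real \<Rightarrow> bool" (infix "\<le>\<^sub>c\<^sub>l\<^sup>l\<^sup>o\<^sup>c\<^sup>a\<^sup>l" 50) where
  "\<alpha> \<le>\<^sub>c\<^sub>l\<^sup>l\<^sup>o\<^sup>c\<^sup>a\<^sup>l \<beta> \<longleftrightarrow>
     (\<exists>b>\<beta>. \<exists>f. lipschitz_continuous_on {0..b} f \<and> computable_on {0..b} f \<and> f \<beta> = \<alpha>)"

end

theory Submission imports Defs begin

text \<open>
  One function \<open>f\<close> serves all three parts.  Sample the translation function on the dyadic grid
  of mesh \<open>2 ^ -n\<close> and let a curve of slope at most \<open>c\<close> climb towards the samples; the curve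
  lies below \<open>\<alpha>\<close> left of \<open>\<beta>\<close> and misses \<open>\<alpha> - c * (\<beta> - x)\<close> by only \<open>O(2 ^ -n)\<close>.  Combine the
  curves for \<open>n = 0, 1, \<dots>\<close> one after the other, the running result moving towards the
  \<open>n\<close>-th curve by at most \<open>3 * c * 2 ^ -n\<close>.  This bound makes the convergence effective
  everywhere, whatever the samples are, while left of \<open>\<beta>\<close> it is generous enough for the lower
  bound to survive.  The limit \<open>f\<close> is monotone, \<open>c\<close>-Lipschitz and satisfies
  \<open>\<alpha> - c * (\<beta> - x) \<le> f x \<le> \<alpha>\<close> for \<open>x < \<beta>\<close>.  Only samples at points \<open>\<le> x\<close> enter \<open>f x\<close>, and an
  approximation of \<open>x\<close> from below is always available, so \<open>f\<close> is computable wherever the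
  samples exist.  If \<open>f x = \<alpha>\<close> for some \<open>x < \<beta>\<close>, then \<open>f\<close> takes the value \<open>\<alpha>\<close> at a rational
  point, and \<open>\<alpha>\<close> is computable.
\<close>

section \<open>Computable functions of a state\<close>

primrec const_prog :: "nat \<Rightarrow> prog" where
  "const_prog 0 = Zero"
| "const_prog (Suc n) = Comp Succ [const_prog n]"

lemma evals_const_prog: "evals A (const_prog n) xs n"
  by (induction n) (auto intro: evals.intros)

text \<open>Hardwires a constant oracle. With \<open>c = 0\<close> it makes an oracle-free program
  usable under any oracle; with \<open>c\<close> the code of a rational it removes an oracle that
  lists a constant sequence.\<close>

fun fix_query :: "nat \<Rightarrow> prog \<Rightarrow> prog" where
  "fix_query c Query = const_prog c"
| "fix_query c (Comp p qs) = Comp (fix_query c p) (map (fix_query c) qs)"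
| "fix_query c (PrimRec p q) = PrimRec (fix_query c p) (fix_query c q)"
| "fix_query c (Mu p) = Mu (fix_query c p)"
| "fix_query c p = p"

lemma evals_fix_query: "evals (\<lambda>_. c) p xs v \<Longrightarrow> evals A (fix_query c p) xs v"
proof (induction p xs v rule: evals.induct)
  case (evals_Comp xs qs ys p v)
  have "list_all2 (\<lambda>q y. evals A q xs y) (map (fix_query c) qs) ys"
    using evals_Comp.IH(1) by (auto simp: list_all2_conv_all_nth)
  then show ?case using evals_Comp.IH(2) by (auto intro: evals.evals_Comp)
next
  case (evals_Mu p n xs)
  then show ?case by (auto intro!: evals.evals_Mu)
qed (auto intro: evals.intros evals_const_prog)

text \<open>A state bundles everything a run depends on: oracle, arguments and intended output. The
  program is chosen before the state, so computability is uniform on \<open>S\<close>.\<close>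

definition computes ::
    "'s set \<Rightarrow> ('s \<Rightarrow> nat \<Rightarrow> nat) \<Rightarrow> ('s \<Rightarrow> nat list) \<Rightarrow> ('s \<Rightarrow> nat) \<Rightarrow> bool" where
  "computes S A xs F \<longleftrightarrow> (\<exists>p. \<forall>s\<in>S. evals (A s) p (xs s) (F s))"

text \<open>Primitive recursion hands the whole argument list on through projections, so a single
  program has to know its length.\<close>

definition const_len :: "('s \<Rightarrow> nat list) \<Rightarrow> bool" where
  "const_len xs \<longleftrightarrow> (\<exists>k. \<forall>s. length (xs s) = k)"

lemma const_len_intros:
  "const_len (\<lambda>s. [])" "const_len xs \<Longrightarrow> const_len (\<lambda>s. x s # xs s)"
  by (auto simp: const_len_def)

lemma computes_cong:
  "computes S A xs F \<Longrightarrow> (\<And>s. s \<in> S \<Longrightarrow> F s = G s) \<Longrightarrow> computes S A xs G"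
  unfolding computes_def by metis

lemma computes_const: "computes S A xs (\<lambda>s. n)"
  unfolding computes_def using evals_const_prog by blast

text \<open>Six positions suffice: two inputs and two nested recursions, each putting a counter and
  an accumulated value in front.\<close>

lemma computes_arg:
  "computes S A (\<lambda>s. x s # r0 s) x"
  "computes S A (\<lambda>s. x0 s # x s # r1 s) x"
  "computes S A (\<lambda>s. x0 s # x1 s # x s # r2 s) x"
  "computes S A (\<lambda>s. x0 s # x1 s # x2 s # x s # r3 s) x"
  "computes S A (\<lambda>s. x0 s # x1 s # x2 s # x3 s # x s # r4 s) x"
  "computes S A (\<lambda>s. x0 s # x1 s # x2 s # x3 s # x4 s # x s # r5 s) x"
proof -
  have *: "computes S A xs F" if "\<And>s. i < length (xs s) \<and> xs s ! i = F s" for i F xs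
    unfolding computes_def using evals_Proj[of i "xs _"] that
    by (metis (no_types))
  show "computes S A (\<lambda>s. x s # r0 s) x" by (rule *[of 0]) simp
  show "computes S A (\<lambda>s. x0 s # x s # r1 s) x" by (rule *[of 1]) simp
  show "computes S A (\<lambda>s. x0 s # x1 s # x s # r2 s) x" by (rule *[of 2]) simp
  show "computes S A (\<lambda>s. x0 s # x1 s # x2 s # x s # r3 s) x"
    by (rule *[of 3]) (simp add: eval_nat_numeral)
  show "computes S A (\<lambda>s. x0 s # x1 s # x2 s # x3 s # x s # r4 s) x"
    by (rule *[of 4]) (simp add: eval_nat_numeral)
  show "computes S A (\<lambda>s. x0 s # x1 s # x2 s # x3 s # x4 s # x s # r5 s) x"
    by (rule *[of 5]) (simp add: eval_nat_numeral)
qed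

lemma computes_comp:
  assumes p: "\<And>s. s \<in> S \<Longrightarrow> evals (A s) p (map (\<lambda>G. G s) Gs) (F s)"
    and Gs: "\<And>G. G \<in> set Gs \<Longrightarrow> computes S A xs G"
  shows "computes S A xs F"
proof -
  have "\<exists>ps. \<forall>s\<in>S. list_all2 (\<lambda>q y. evals (A s) q (xs s) y) ps (map (\<lambda>G. G s) Gs)"
    using Gs
  proof (induction Gs)
    case Nil
    show ?case by (intro exI[of _ "[]"]) simp
  next
    case (Cons G Gs)
    have "\<And>H. H \<in> set Gs \<Longrightarrow> computes S A xs H" using Cons.prems by simp
    from Cons.IH[OF this] obtain ps
      where ps: "\<forall>s\<in>S. list_all2 (\<lambda>q y. evals (A s) q (xs s) y) ps (map (\<lambda>G. G s) Gs)"
      by metis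
    have "computes S A xs G" using Cons.prems by simp
    then obtain q where "\<forall>s\<in>S. evals (A s) q (xs s) (G s)"
      unfolding computes_def ..
    with ps show ?case by (intro exI[of _ "q # ps"]) simp
  qed
  then obtain ps
    where ps: "\<forall>s\<in>S. list_all2 (\<lambda>q y. evals (A s) q (xs s) y) ps (map (\<lambda>G. G s) Gs)" ..
  have "evals (A s) (Comp p ps) (xs s) (F s)" if "s \<in> S" for s
    using ps that by (intro evals_Comp[OF _ p]) simp_all
  then show ?thesis
    unfolding computes_def by metis
qed

lemma computes_1:
  assumes "\<And>s. s \<in> S \<Longrightarrow> evals (A s) p [G s] (F s)" and "computes S A xs G"
  shows "computes S A xs F"
proof (rule computes_comp)
  show "evals (A s) p (map (\<lambda>G. G s) [G]) (F s)" if "s \<in> S" for s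
    using assms(1)[OF that] by simp
  show "computes S A xs H" if "H \<in> set [G]" for H
    using that assms(2) by simp
qed

lemma computes_Suc: "computes S A xs F \<Longrightarrow> computes S A xs (\<lambda>s. Suc (F s))"
  by (rule computes_1[where p = Succ, OF evals_Succ])

lemma computes_query: "computes S A xs F \<Longrightarrow> computes S A xs (\<lambda>s. A s (F s))"
  by (rule computes_1[where p = Query, OF evals_Query])

text \<open>The step has to be computable only for counters \<open>m < N s\<close>. This bound later
  confines the sampled points to the part of the grid where the translation function is known to be
  defined.\<close>

lemma computes_rec:
  assumes Z: "computes S A xs Z" and N: "computes S A xs N"
    and G: "computes {w. snd (snd w) \<in> S \<and> fst w < N (snd (snd w))} (\<lambda>w. A (snd (snd w)))
        (\<lambda>w. fst w # fst (snd w) # xs (snd (snd w)))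
        (\<lambda>w. G (snd (snd w)) (fst w) (fst (snd w)))"
    and len: "const_len xs"
  shows "computes S A xs (\<lambda>s. rec_nat (Z s) (\<lambda>m u. G s m u) (N s))"
proof -
  obtain k where k: "\<And>s. length (xs s) = k" using len by (auto simp: const_len_def)
  obtain pz where pz: "\<And>s. s \<in> S \<Longrightarrow> evals (A s) pz (xs s) (Z s)"
    using Z by (auto simp: computes_def)
  obtain pn where pn: "\<And>s. s \<in> S \<Longrightarrow> evals (A s) pn (xs s) (N s)"
    using N by (auto simp: computes_def)
  obtain pg where pg: "\<And>s m u. s \<in> S \<Longrightarrow> m < N s \<Longrightarrow> evals (A s) pg (m # u # xs s) (G s m u)"
    using G by (auto simp: computes_def)
  have rec: "evals (A s) (PrimRec pz pg) (m # xs s) (rec_nat (Z s) (G s) m)"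
    if "s \<in> S" "m \<le> N s" for s m
    using that by (induction m) (auto intro!: evals_PrimRec_0 evals_PrimRec_Suc pz pg)
  have "list_all2 (\<lambda>q y. evals (A s) q (xs s) y) (map Proj [0..<k]) (xs s)" for s
    by (auto simp: list_all2_conv_all_nth k intro: evals_Proj)
  then have "list_all2 (\<lambda>q y. evals (A s) q (xs s) y) (pn # map Proj [0..<k]) (N s # xs s)"
    if "s \<in> S" for s
    using pn[OF that] by simp
  then show ?thesis
    unfolding computes_def
    by (intro exI[of _ "Comp (PrimRec pz pg) (pn # map Proj [0..<k])"] ballI)
      (auto intro!: evals_Comp rec)
qed

text \<open>The state in the first premise pairs an arbitrary oracle with an argument, so one
  program for \<open>f\<close> serves under every oracle and can be called in any state.\<close>

lemma computes_unary:
  assumes "computes UNIV fst (\<lambda>s. [snd s]) (\<lambda>s. f (snd s))" and "computes S A xs F"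
  shows "computes S A xs (\<lambda>s. f (F s))"
proof -
  obtain p where "\<And>A x. evals A p [x] (f x)"
    using assms(1) by (auto simp: computes_def)
  then show ?thesis using assms(2) by (rule computes_1)
qed

lemma computes_binary:
  assumes "computes UNIV fst (\<lambda>s. [fst (snd s), snd (snd s)]) (\<lambda>s. f (fst (snd s)) (snd (snd s)))"
    and "computes S A xs F" and "computes S A xs G"
  shows "computes S A xs (\<lambda>s. f (F s) (G s))"
proof -
  obtain p where p: "\<And>A x y. evals A p [x, y] (f x y)"
    using assms(1) by (auto simp: computes_def)
  show ?thesis
  proof (rule computes_comp)
    show "evals (A s) p (map (\<lambda>G. G s) [F, G]) (f (F s) (G s))" for s
      using p by simp
    show "computes S A xs H" if "H \<in> set [F, G]" for H
      using that assms(2,3) by auto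
  qed
qed

section \<open>Arithmetic\<close>

lemma computes_plus:
  "computes S A xs F \<Longrightarrow> computes S A xs G \<Longrightarrow> computes S A xs (\<lambda>s. F s + G s)"
proof (rule computes_binary[where f = "(+)"])
  have "rec_nat x (\<lambda>m u. Suc u) y = x + y" for x y by (induction y) auto
  moreover have "computes UNIV fst (\<lambda>s. [fst (snd s), snd (snd s)])
      (\<lambda>s. rec_nat (fst (snd s)) (\<lambda>m u. Suc u) (snd (snd s)))"
    by (intro computes_rec computes_arg computes_Suc const_len_intros)
  ultimately show "computes UNIV fst (\<lambda>s. [fst (snd s), snd (snd s)])
      (\<lambda>s. fst (snd s) + snd (snd s))" by simp
qed

lemma computes_pred: "computes S A xs F \<Longrightarrow> computes S A xs (\<lambda>s. F s - 1)"
proof (rule computes_unary[where f = "\<lambda>x. x - 1"])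
  have "rec_nat 0 (\<lambda>m u. m) y = y - 1" for y by (cases y) auto
  moreover have "computes UNIV fst (\<lambda>s. [snd s]) (\<lambda>s. rec_nat 0 (\<lambda>m u. m) (snd s))"
    by (intro computes_rec computes_arg computes_const const_len_intros)
  ultimately show "computes UNIV fst (\<lambda>s. [snd s]) (\<lambda>s. snd s - 1)" by simp
qed

lemma computes_minus:
  "computes S A xs F \<Longrightarrow> computes S A xs G \<Longrightarrow> computes S A xs (\<lambda>s. F s - G s)"
proof (rule computes_binary[where f = "(-)"])
  have "rec_nat x (\<lambda>m u. u - 1) y = x - y" for x y by (induction y) auto
  moreover have "computes UNIV fst (\<lambda>s. [fst (snd s), snd (snd s)])
      (\<lambda>s. rec_nat (fst (snd s)) (\<lambda>m u. u - 1) (snd (snd s)))"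
    by (intro computes_rec computes_arg computes_pred const_len_intros)
  ultimately show "computes UNIV fst (\<lambda>s. [fst (snd s), snd (snd s)])
      (\<lambda>s. fst (snd s) - snd (snd s))" by simp
qed

lemma computes_times:
  "computes S A xs F \<Longrightarrow> computes S A xs G \<Longrightarrow> computes S A xs (\<lambda>s. F s * G s)"
proof (rule computes_binary[where f = "(*)"])
  have "rec_nat 0 (\<lambda>m u. u + x) y = x * y" for x y by (induction y) auto
  moreover have "computes UNIV fst (\<lambda>s. [fst (snd s), snd (snd s)])
      (\<lambda>s. rec_nat 0 (\<lambda>m u. u + fst (snd s)) (snd (snd s)))"
    by (intro computes_rec computes_arg computes_plus computes_const const_len_intros)
  ultimately show "computes UNIV fst (\<lambda>s. [fst (snd s), snd (snd s)])
      (\<lambda>s. fst (snd s) * snd (snd s))" by simp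
qed

lemma computes_power:
  "computes S A xs F \<Longrightarrow> computes S A xs G \<Longrightarrow> computes S A xs (\<lambda>s. F s ^ G s)"
proof (rule computes_binary[where f = "(^)"])
  have "rec_nat 1 (\<lambda>m u. u * x) y = x ^ y" for x y :: nat by (induction y) auto
  moreover have "computes UNIV fst (\<lambda>s. [fst (snd s), snd (snd s)])
      (\<lambda>s. rec_nat 1 (\<lambda>m u. u * fst (snd s)) (snd (snd s)))"
    by (intro computes_rec computes_arg computes_times computes_const const_len_intros)
  ultimately show "computes UNIV fst (\<lambda>s. [fst (snd s), snd (snd s)])
      (\<lambda>s. fst (snd s) ^ snd (snd s))" by simp
qed

lemma computes_min:
  assumes "computes S A xs F" and "computes S A xs G"
  shows "computes S A xs (\<lambda>s. min (F s) (G s))"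
proof (rule computes_cong)
  show "computes S A xs (\<lambda>s. F s - (F s - G s))" by (intro computes_minus assms)
qed auto

lemma computes_le:
  assumes "computes S A xs F" and "computes S A xs G"
  shows "computes S A xs (\<lambda>s. of_bool (F s \<le> G s))"
proof (rule computes_cong)
  show "computes S A xs (\<lambda>s. 1 - (F s - G s))" by (intro computes_minus computes_const assms)
qed auto

lemma computes_eq:
  assumes "computes S A xs F" and "computes S A xs G"
  shows "computes S A xs (\<lambda>s. of_bool (F s = G s))"
proof (rule computes_cong)
  show "computes S A xs (\<lambda>s. of_bool (F s \<le> G s) * of_bool (G s \<le> F s))"
    by (intro computes_times computes_le assms)
qed auto

lemma computes_sum:
  assumes "computes S A xs N"
    and "computes {w. snd (snd w) \<in> S \<and> fst w < N (snd (snd w))} (\<lambda>w. A (snd (snd w)))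
        (\<lambda>w. fst w # fst (snd w) # xs (snd (snd w))) (\<lambda>w. F (snd (snd w)) (fst w))"
    and "const_len xs"
  shows "computes S A xs (\<lambda>s. \<Sum>m<N s. F s m)"
proof (rule computes_cong)
  show "computes S A xs (\<lambda>s. rec_nat 0 (\<lambda>m u. u + F s m) (N s))"
    by (intro computes_rec computes_plus computes_const assms computes_arg)
  have "rec_nat 0 (\<lambda>m u. u + f m) n = (\<Sum>m<n. f m)" for f :: "nat \<Rightarrow> nat" and n
    by (induction n) auto
  then show "rec_nat 0 (\<lambda>m u. u + F s m) (N s) = (\<Sum>m<N s. F s m)" for s .
qed

lemmas computes_intros = computes_arg computes_const computes_plus computes_minus computes_times
  computes_power computes_min computes_le computes_eq computes_rec computes_sum const_len_intros

lemma sum_of_bool_less: "k \<le> n \<Longrightarrow> (\<Sum>t<n. of_bool (t < k)) = (k :: nat)"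
proof -
  have "(\<Sum>t<n. of_bool (t < k)) = min n k" by (induction n) auto
  then show "k \<le> n \<Longrightarrow> (\<Sum>t<n. of_bool (t < k)) = k" by simp
qed

section \<open>Division, remainder and pairing\<close>

lemma computes_div:
  "computes S A xs F \<Longrightarrow> computes S A xs G \<Longrightarrow> computes S A xs (\<lambda>s. F s div G s)"
proof (rule computes_binary[where f = "(div)"])
  \<comment> \<open>The quotient counts the positive multiples of \<open>y\<close> up to
    \<open>x\<close>; the factor in front supplies the value 0 for division by zero.\<close>
  have "of_bool (1 \<le> y) * (\<Sum>t<x. of_bool ((t + 1) * y \<le> x)) = x div y" for x y :: nat
  proof (cases "y = 0")
    case False
    then have "(t + 1) * y \<le> x \<longleftrightarrow> t < x div y" for t
      using less_eq_div_iff_mult_less_eq[of y "t + 1" x] by (simp add: Suc_le_eq)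
    then have "(\<Sum>t<x. of_bool ((t + 1) * y \<le> x)) = (\<Sum>t<x. of_bool (t < x div y) :: nat)"
      by (intro sum.cong arg_cong[where f = of_bool]) blast+
    also have "\<dots> = x div y" by (intro sum_of_bool_less div_le_dividend)
    finally have "(\<Sum>t<x. of_bool ((t + 1) * y \<le> x)) = x div y" .
    with False show ?thesis by simp
  qed simp
  moreover have "computes UNIV fst (\<lambda>s. [fst (snd s), snd (snd s)])
      (\<lambda>s. of_bool (1 \<le> snd (snd s)) *
        (\<Sum>t<fst (snd s). of_bool ((t + 1) * snd (snd s) \<le> fst (snd s))))"
    by (intro computes_intros)
  ultimately show "computes UNIV fst (\<lambda>s. [fst (snd s), snd (snd s)])
      (\<lambda>s. fst (snd s) div snd (snd s))" by simp
qed

lemma computes_mod: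
  assumes "computes S A xs F" and "computes S A xs G"
  shows "computes S A xs (\<lambda>s. F s mod G s)"
proof (rule computes_cong)
  show "computes S A xs (\<lambda>s. F s - F s div G s * G s)"
    by (intro computes_minus computes_times computes_div assms)
qed (simp add: minus_div_mult_eq_mod)

lemma computes_prod_encode:
  assumes "computes S A xs F" and "computes S A xs G"
  shows "computes S A xs (\<lambda>s. prod_encode (F s, G s))"
proof (rule computes_cong)
  show "computes S A xs (\<lambda>s. (F s + G s) * (F s + G s + 1) div 2 + F s)"
    by (intro computes_intros computes_div assms)
qed (simp add: prod_encode_def triangle_def)

text \<open>The antidiagonal on which \<open>z\<close> lies in Cantor's enumeration, found by
  counting the positive triangular numbers up to \<open>z\<close>.\<close>

definition diagonal :: "nat \<Rightarrow> nat" where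
  "diagonal z = (\<Sum>t<z. of_bool ((t + 1) * (t + 2) div 2 \<le> z))"

lemma diagonal_prod_encode: "diagonal (prod_encode (m, n)) = m + n"
proof -
  let ?z = "prod_encode (m, n)"
  have tri: "(t + 1) * (t + 2) div 2 = triangle (Suc t)" for t
    by (simp add: triangle_def)
  have mono: "triangle i \<le> triangle j" if "i \<le> j" for i j
    using that by (induction rule: dec_induct) auto
  have ge: "k \<le> triangle k" for k by (induction k) auto
  have "(t + 1) * (t + 2) div 2 \<le> ?z \<longleftrightarrow> t < m + n" for t
  proof
    assume "t < m + n"
    then show "(t + 1) * (t + 2) div 2 \<le> ?z"
      using mono[of "Suc t" "m + n"] unfolding tri by (simp add: prod_encode_def)
  next
    assume le: "(t + 1) * (t + 2) div 2 \<le> ?z"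
    show "t < m + n"
    proof (rule ccontr)
      assume "\<not> t < m + n"
      then have "triangle (Suc (m + n)) \<le> triangle (Suc t)" by (intro mono) simp
      with le show False unfolding tri by (simp add: prod_encode_def)
    qed
  qed
  then have "diagonal ?z = (\<Sum>t<?z. of_bool (t < m + n) :: nat)"
    unfolding diagonal_def by (intro sum.cong arg_cong[where f = of_bool]) blast+
  also have "\<dots> = m + n"
    using ge[of "m + n"] by (intro sum_of_bool_less) (simp add: prod_encode_def)
  finally show ?thesis .
qed

text \<open>Since \<open>prod_encode (m, n) = triangle (m + n) + m\<close>, knowing the antidiagonal
  \<open>m + n\<close> gives first \<open>m\<close> and then \<open>n\<close>.\<close>

lemma prod_decode_diagonal:
  "prod_decode z = (z - triangle (diagonal z), diagonal z - (z - triangle (diagonal z)))"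
proof -
  obtain m n where z: "z = prod_encode (m, n)" by (metis prod_decode_inverse surj_pair)
  show ?thesis unfolding z diagonal_prod_encode prod_encode_inverse
    by (simp add: prod_encode_def)
qed

lemma computes_diagonal:
  "computes S A xs F \<Longrightarrow> computes S A xs (\<lambda>s. diagonal (F s))"
  by (erule computes_unary[rotated], unfold diagonal_def) (intro computes_intros computes_div)

lemma computes_fst_prod_decode:
  assumes "computes S A xs F"
  shows "computes S A xs (\<lambda>s. fst (prod_decode (F s)))"
  unfolding prod_decode_diagonal fst_conv triangle_def
  by (intro computes_minus computes_div computes_times computes_Suc computes_diagonal
    computes_const assms)

lemma computes_snd_prod_decode:
  assumes "computes S A xs F"
  shows "computes S A xs (\<lambda>s. snd (prod_decode (F s)))"
  unfolding prod_decode_diagonal snd_conv triangle_def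
  by (intro computes_minus computes_div computes_times computes_Suc computes_diagonal
    computes_const assms)

section \<open>Codes of rationals in lowest terms, and rounding\<close>

definition gcd_step :: "nat \<Rightarrow> nat \<Rightarrow> nat \<Rightarrow> nat \<Rightarrow> nat" where
  "gcd_step a b m u = of_bool (a mod (m + 1) = 0) * of_bool (b mod (m + 1) = 0) * (m + 1)
     + (1 - of_bool (a mod (m + 1) = 0) * of_bool (b mod (m + 1) = 0)) * u"

text \<open>The recursion remembers the last common divisor met among 1, ..., \<open>n\<close>,
  which is the largest. Searching past the gcd changes nothing, so the bound \<open>b\<close> will
  do.\<close>

lemma rec_nat_gcd_step:
  assumes "b > 0" and "gcd a b \<le> n"
  shows "rec_nat 0 (gcd_step a b) n = gcd a b"
  using assms(2)
proof (induction n)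
  case 0
  with \<open>b > 0\<close> show ?case by simp
next
  case (Suc n)
  show ?case
  proof (cases "gcd a b = Suc n")
    case True
    then have "Suc n dvd a" "Suc n dvd b" by (metis gcd_dvd1, metis gcd_dvd2)
    with True show ?thesis by (simp add: gcd_step_def dvd_eq_mod_eq_0)
  next
    case False
    then have lt: "gcd a b < Suc n" using Suc.prems by simp
    have "\<not> (Suc n dvd a \<and> Suc n dvd b)"
    proof
      assume "Suc n dvd a \<and> Suc n dvd b"
      then have "Suc n dvd gcd a b" by simp
      with lt \<open>b > 0\<close> show False by (metis dvd_imp_le gcd_pos_nat not_le neq0_conv)
    qed
    then show ?thesis using Suc.IH lt by (auto simp: gcd_step_def dvd_eq_mod_eq_0)
  qed
qed

text \<open>The division by \<open>d\<close> is forced because \<open>rat_code\<close> uses lowest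
  terms; the factor 2 is how \<open>int_encode\<close> codes a nonnegative numerator.\<close>

definition frac_code :: "nat \<Rightarrow> nat \<Rightarrow> nat" where
  "frac_code a b = (let d = rec_nat 0 (gcd_step a b) b in prod_encode (2 * (a div d), b div d))"

lemma frac_code_eq: "b > 0 \<Longrightarrow> frac_code a b = rat_code (of_nat a / of_nat b)"
proof -
  assume "b > 0"
  then have d: "rec_nat 0 (gcd_step a b) b = gcd a b" by (intro rec_nat_gcd_step) auto
  have "quotient_of (of_nat a / of_nat b) = Rat.normalize (int a, int b)"
    using quotient_of_Fract[of "int a" "int b"] by (simp add: Fract_of_int_quotient)
  also have "\<dots> = (int (a div gcd a b), int (b div gcd a b))"
    using \<open>b > 0\<close> by (simp add: Rat.normalize_def zdiv_int Let_def flip: gcd_int_int_eq)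
  finally show ?thesis
    by (simp add: frac_code_def rat_code_def d int_encode_def sum_encode_def Let_def)
qed

lemma computes_frac_code:
  "computes S A xs F \<Longrightarrow> computes S A xs G \<Longrightarrow> computes S A xs (\<lambda>s. frac_code (F s) (G s))"
  by (erule computes_binary[rotated], assumption, unfold frac_code_def Let_def gcd_step_def)
    (intro computes_intros computes_div computes_prod_encode computes_mod)

text \<open>An odd first component codes a negative numerator; the result is then 0, in agreement
  with \<open>nat\<close> of a negative floor.\<close>

definition floor_code :: "nat \<Rightarrow> nat \<Rightarrow> nat" where
  "floor_code n z = of_bool (fst (prod_decode z) mod 2 = 0) *
     (2 ^ n * (fst (prod_decode z) div 2) div snd (prod_decode z))"

lemma floor_code_rat_code: "floor_code n (rat_code q) = nat \<lfloor>2 ^ n * real_of_rat q\<rfloor>"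
proof -
  have "\<lfloor>2 ^ n * real_of_rat q\<rfloor> = \<lfloor>2 ^ n * q\<rfloor>"
    using of_rat_floor[of "2 ^ n * q", where ?'a = real] by (simp add: of_rat_mult of_rat_power)
  moreover have "floor_code n (rat_code q) = nat \<lfloor>2 ^ n * q\<rfloor>"
  proof -
    obtain a b where ab: "quotient_of q = (a, b)" by fastforce
    then have "b > 0" by (rule quotient_of_denom_pos)
    have q: "q = of_int a / of_int b" using ab by (rule quotient_of_div)
    show ?thesis
    proof (cases "a \<ge> 0")
      case True
      have "\<lfloor>2 ^ n * q\<rfloor> = (2 ^ n * a) div b"
        unfolding q using floor_divide_of_int_eq[of "2 ^ n * a" b, where ?'a = rat] by simp
      then have "nat \<lfloor>2 ^ n * q\<rfloor> = 2 ^ n * nat a div nat b"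
        using True \<open>b > 0\<close> by (simp add: nat_div_distrib nat_mult_distrib nat_power_eq)
      then show ?thesis
        using True by (simp add: floor_code_def rat_code_def ab int_encode_def sum_encode_def)
    next
      case False
      then have "2 ^ n * q \<le> 0" unfolding q using \<open>b > 0\<close> by (simp add: divide_le_0_iff mult_le_0_iff)
      then have "nat \<lfloor>2 ^ n * q\<rfloor> = 0" by (simp add: floor_le_iff)
      then show ?thesis
        using False by (simp add: floor_code_def rat_code_def ab int_encode_def sum_encode_def)
    qed
  qed
  ultimately show ?thesis by simp
qed

lemma computes_floor_code:
  "computes S A xs F \<Longrightarrow> computes S A xs G \<Longrightarrow> computes S A xs (\<lambda>s. floor_code (F s) (G s))"
  unfolding floor_code_def
  by (intro computes_intros computes_div computes_mod computes_fst_prod_decode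
    computes_snd_prod_decode)

section \<open>Slope-limited approximations\<close>

definition climb :: "nat \<Rightarrow> nat \<Rightarrow> nat \<Rightarrow> nat" where
  "climb d u v = u + min d (v - u)"

lemma climb_alt: "climb d u v = max u (min v (u + d))"
  by (simp add: climb_def)

lemma climb_double: "climb (2 * d) (2 * u) (2 * v) = 2 * climb d u v"
  unfolding climb_def diff_mult_distrib2[symmetric] by (simp add: min_def)

text \<open>Together with \<open>climb_double\<close> this makes refinement of the grid exact: two
  small steps towards one target are one step of double width.\<close>

lemma climb_twice: "climb d (climb d u v) v = climb (2 * d) u v"
  unfolding climb_def by linarith

lemma climb_bounds: "u \<le> climb d u v" "climb d u v \<le> u + d"
  by (simp_all add: climb_def)

text \<open>
  All heights at resolution \<open>N\<close> are measured in units of \<open>2 ^ -N\<close>, and \<open>t\<close> stands for the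
  point \<open>t / 2 ^ N\<close>; the sample \<open>a n j\<close> is a height at the point \<open>j / 2 ^ n\<close> in units of
  \<open>2 ^ -n\<close>.  Climbing reacts to the sample at the left end of the current cell only.
\<close>

definition sweep :: "nat \<Rightarrow> (nat \<Rightarrow> nat \<Rightarrow> nat) \<Rightarrow> nat \<Rightarrow> nat \<Rightarrow> nat \<Rightarrow> nat" where
  "sweep c a N n t = rec_nat 0 (\<lambda>i u. climb c u (2 ^ (N - n) * a n (i div 2 ^ (N - n)))) t"

definition level :: "nat \<Rightarrow> (nat \<Rightarrow> nat \<Rightarrow> nat) \<Rightarrow> nat \<Rightarrow> nat \<Rightarrow> nat \<Rightarrow> nat" where
  "level c a N m t = rec_nat 0 (\<lambda>n u. climb (3 * c * 2 ^ (N - n)) u (sweep c a N n t)) m"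

definition height :: "nat \<Rightarrow> (nat \<Rightarrow> nat \<Rightarrow> nat) \<Rightarrow> nat \<Rightarrow> nat \<Rightarrow> nat" where
  "height c a N t = level c a N N t"

lemma sweep_simps [simp]:
  "sweep c a N n 0 = 0"
  "sweep c a N n (Suc t) = climb c (sweep c a N n t) (2 ^ (N - n) * a n (t div 2 ^ (N - n)))"
  by (simp_all add: sweep_def)

lemma level_simps [simp]:
  "level c a N 0 t = 0"
  "level c a N (Suc m) t = climb (3 * c * 2 ^ (N - m)) (level c a N m t) (sweep c a N m t)"
  by (simp_all add: level_def)

text \<open>The points \<open>2 * t\<close> and \<open>2 * t + 1\<close> of the finer grid lie in
  the same cell, so both steps aim at the same sample and merge by
  \<open>climb_twice\<close>.\<close>

lemma sweep_double: "n \<le> N \<Longrightarrow> sweep c a (Suc N) n (2 * t) = 2 * sweep c a N n t"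
proof (induction t)
  case (Suc t)
  define k where "k = N - n"
  have k: "Suc N - n = Suc k" using Suc.prems by (simp add: k_def)
  have "2 * t div 2 ^ Suc k = t div 2 ^ k" "Suc (2 * t) div 2 ^ Suc k = t div 2 ^ k"
    by (simp_all add: div_mult2_eq)
  then have "sweep c a (Suc N) n (2 * Suc t)
      = climb (2 * c) (2 * sweep c a N n t) (2 * (2 ^ k * a n (t div 2 ^ k)))"
    using Suc.IH[OF Suc.prems] by (simp add: k climb_twice mult.assoc)
  then show ?case by (simp add: climb_double k_def)
qed simp

lemma level_double: "m \<le> Suc N \<Longrightarrow> level c a (Suc N) m (2 * t) = 2 * level c a N m t"
proof (induction m)
  case (Suc m)
  then have width: "3 * c * 2 ^ (Suc N - m) = 2 * (3 * c * 2 ^ (N - m))"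
    by (simp add: Suc_diff_le)
  have "level c a (Suc N) m (2 * t) = 2 * level c a N m t" using Suc by simp
  moreover have "sweep c a (Suc N) m (2 * t) = 2 * sweep c a N m t"
    using Suc.prems by (intro sweep_double) simp
  ultimately show ?case unfolding level_simps width by (simp only: climb_double)
qed simp

lemma sweep_Suc_bounds:
  "sweep c a N n t \<le> sweep c a N n (Suc t)" "sweep c a N n (Suc t) \<le> sweep c a N n t + c"
  by (simp_all add: climb_bounds)

text \<open>If \<open>u\<close> and \<open>v\<close> each grow by an amount between 0 and
  \<open>c\<close>, so do \<open>u + d\<close>, the minimum with \<open>v\<close> and the maximum
  with \<open>u\<close>; by \<open>climb_alt\<close>, \<open>climb\<close> is built from
  these.\<close>

lemma level_Suc_bounds:
  "level c a N m t \<le> level c a N m (Suc t) \<and> level c a N m (Suc t) \<le> level c a N m t + c"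
proof (induction m)
  case (Suc m)
  then show ?case
    using sweep_Suc_bounds[of c a N m t] unfolding level_simps climb_alt by linarith
qed simp

lemma height_bounds:
  assumes "s \<le> t"
  shows "height c a N s \<le> height c a N t" "height c a N t \<le> height c a N s + c * (t - s)"
proof -
  have "height c a N s \<le> height c a N t \<and> height c a N t \<le> height c a N s + c * (t - s)"
    using assms
  proof (induction rule: dec_induct)
    case (step t)
    then show ?case
      using level_Suc_bounds[of c a N N t] by (simp add: height_def Suc_diff_le)
  qed simp
  then show "height c a N s \<le> height c a N t" "height c a N t \<le> height c a N s + c * (t - s)"
    by simp_all
qed

text \<open>At even points only the curve of index \<open>N\<close> is new, and it moves the height
  by at most \<open>3 * c * 2 = 6 * c\<close> fine units. One more \<open>c\<close> pays for an odd
  \<open>t'\<close>.\<close>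

lemma height_refine:
  assumes "t' div 2 = t"
  shows "2 * height c a N t \<le> height c a (Suc N) t'"
    and "height c a (Suc N) t' \<le> 2 * height c a N t + 7 * c"
proof -
  have eq: "height c a (Suc N) (2 * t) = climb (6 * c) (2 * height c a N t) (sweep c a (Suc N) N (2 * t))"
    by (simp add: height_def level_double del: sweep_simps)
  have t': "2 * t \<le> t'" "t' - 2 * t \<le> 1" using assms by auto
  show "2 * height c a N t \<le> height c a (Suc N) t'"
    using climb_bounds(1) height_bounds(1)[OF t'(1)] unfolding eq[symmetric]
    by (metis climb_bounds(1) eq le_trans)
  have "c * (t' - 2 * t) \<le> c * 1" using t'(2) by (rule mult_le_mono2)
  then have "height c a (Suc N) t' \<le> height c a (Suc N) (2 * t) + c"
    using height_bounds(2)[OF t'(1), of c a "Suc N"] by linarith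
  then show "height c a (Suc N) t' \<le> 2 * height c a N t + 7 * c"
    using climb_bounds(2)[of "6 * c" "2 * height c a N t" "sweep c a (Suc N) N (2 * t)"]
    unfolding eq by linarith
qed

lemma cell_le:
  assumes "n \<le> N"
  shows "real (i div 2 ^ (N - n)) / 2 ^ n \<le> real i / 2 ^ N"
proof -
  have "(i div 2 ^ (N - n)) * 2 ^ (N - n) \<le> i" by (rule div_times_less_eq_dividend)
  then have "real (i div 2 ^ (N - n)) * 2 ^ (N - n) \<le> real i"
    by (metis of_nat_le_iff of_nat_mult of_nat_numeral of_nat_power)
  moreover have "(2::real) ^ N = 2 ^ (N - n) * 2 ^ n"
    using assms by (simp flip: power_add)
  ultimately show ?thesis by (simp add: field_simps)
qed

section \<open>Bounds for the curves left of \<beta>\<close>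

context
  fixes a :: "nat \<Rightarrow> nat \<Rightarrow> nat" and c :: nat and \<alpha> \<beta> :: real
  assumes upper: "\<And>n j. real j / 2 ^ n < \<beta> \<Longrightarrow> real (a n j) \<le> 2 ^ n * \<alpha>"
    and lower: "\<And>n j. real j / 2 ^ n < \<beta> \<Longrightarrow> 2 ^ n * \<alpha> - c * (2 ^ n * \<beta> - j) - 1 \<le> a n j"
    and alpha: "0 \<le> \<alpha>" "\<alpha> \<le> 1" "\<alpha> \<le> c * \<beta>"
begin

text \<open>Every cell met on the way starts left of \<beta>, so no target lies above
  \<alpha>.\<close>

lemma sweep_upper:
  assumes "n \<le> N" and "real t / 2 ^ N < \<beta>"
  shows "real (sweep c a N n t) \<le> 2 ^ N * \<alpha>"
  using assms(2)
proof (induction t)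
  case 0
  then show ?case using alpha by simp
next
  case (Suc t)
  let ?j = "t div 2 ^ (N - n)"
  have t: "real t / 2 ^ N < \<beta>"
    using Suc.prems by (rule le_less_trans[rotated]) (simp add: divide_right_mono)
  then have "real (a n ?j) \<le> 2 ^ n * \<alpha>"
    using cell_le[OF assms(1), of t] by (intro upper) linarith
  then have "2 ^ (N - n) * real (a n ?j) \<le> 2 ^ (N - n) * (2 ^ n * \<alpha>)"
    by (intro mult_left_mono) auto
  also have "\<dots> = 2 ^ N * \<alpha>"
    using assms(1) by (simp flip: power_add mult.assoc)
  finally have "real (2 ^ (N - n) * a n ?j) \<le> 2 ^ N * \<alpha>" by simp
  with Suc.IH[OF t] show ?case
    unfolding sweep_simps climb_alt of_nat_max of_nat_min by linarith
qed

text \<open>The line on the left rises by \<open>c\<close> per step. A full step of the curve keeps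
  pace with it; otherwise the curve has reached the sample. With \<open>K = 2 ^ (N - n)\<close>
  points per cell, the sample falls short by at most \<open>K\<close> for rounding,
  \<open>c * K\<close> for being read at the left end of the cell and \<open>c \<le> c * K\<close>
  for the step to \<open>Suc t\<close>. The start at 0 is high enough because
  \<open>\<alpha> \<le> c * \<beta>\<close>.\<close>

lemma sweep_lower:
  assumes "n \<le> N" and "real t / 2 ^ N < \<beta>"
  shows "2 ^ N * \<alpha> - c * (2 ^ N * \<beta> - t) - (2 * real c + 1) * 2 ^ (N - n) \<le> sweep c a N n t"
  using assms(2)
proof (induction t)
  case 0
  have "2 ^ N * \<alpha> \<le> 2 ^ N * (c * \<beta>)" using alpha(3) by (intro mult_left_mono) auto
  then have "2 ^ N * \<alpha> - c * (2 ^ N * \<beta> - real 0) \<le> 0" by (simp add: mult.left_commute)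
  moreover have "0 \<le> (2 * real c + 1) * 2 ^ (N - n)" by simp
  ultimately show ?case unfolding sweep_simps by linarith
next
  case (Suc t)
  let ?j = "t div 2 ^ (N - n)"
  define K :: real where "K = 2 ^ (N - n)"
  have "K \<ge> 1" by (simp add: K_def)
  have t: "real t / 2 ^ N < \<beta>"
    using Suc.prems by (rule le_less_trans[rotated]) (simp add: divide_right_mono)
  have pow: "(2::real) ^ N = K * 2 ^ n"
    using assms(1) by (simp add: K_def flip: power_add)
  have "t < (?j + 1) * 2 ^ (N - n)"
    by (metis Suc_eq_plus1 dividend_less_div_times mult_Suc add.commute zero_less_numeral zero_less_power)
  then have "real t < real ((?j + 1) * 2 ^ (N - n))" by (rule of_nat_less_iff[THEN iffD2])
  then have j: "real t \<le> K * real ?j + K" by (simp add: K_def algebra_simps)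
  have "2 ^ n * \<alpha> - c * (2 ^ n * \<beta> - ?j) - 1 \<le> a n ?j"
    using cell_le[OF assms(1), of t] t by (intro lower) linarith
  then have "K * (2 ^ n * \<alpha> - c * (2 ^ n * \<beta> - ?j) - 1) \<le> K * a n ?j"
    using \<open>K \<ge> 1\<close> by (intro mult_left_mono) auto
  then have "2 ^ N * \<alpha> - c * (2 ^ N * \<beta>) + c * (K * ?j) - K \<le> K * a n ?j"
    by (simp add: pow algebra_simps)
  moreover have "c * real t \<le> c * (K * ?j + K)"
    using j by (rule mult_left_mono) simp
  moreover have "real c * 1 \<le> c * K" using \<open>K \<ge> 1\<close> by (rule mult_left_mono) simp
  ultimately have "2 ^ N * \<alpha> - c * (2 ^ N * \<beta> - Suc t) - (2 * real c + 1) * K \<le> K * a n ?j"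
    by (simp add: algebra_simps)
  then have "2 ^ N * \<alpha> - c * (2 ^ N * \<beta> - Suc t) - (2 * real c + 1) * K \<le> real (2 ^ (N - n) * a n ?j)"
    by (simp add: K_def)
  moreover have "2 ^ N * \<alpha> - c * (2 ^ N * \<beta> - Suc t) - (2 * real c + 1) * K \<le> real (sweep c a N n t + c)"
    using Suc.IH[OF t] by (simp add: K_def algebra_simps)
  ultimately show ?case
    unfolding sweep_simps climb_alt of_nat_max of_nat_min K_def by linarith
qed

lemma level_upper:
  assumes "real t / 2 ^ N < \<beta>"
  shows "m \<le> N \<Longrightarrow> real (level c a N m t) \<le> 2 ^ N * \<alpha>"
proof (induction m)
  case (Suc m)
  then show ?case
    using sweep_upper[of m N t] assms
    unfolding level_simps climb_alt of_nat_max of_nat_min by linarith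
qed (use alpha in simp)

text \<open>The allowed deficit halves with every curve. Put \<open>K = 2 ^ (N - Suc m)\<close>: the
  next curve has deficit at most \<open>(2 * c + 1) * 2 * K \<le> 6 * c * K\<close>, using
  \<open>1 \<le> c\<close>, and the permitted move \<open>3 * c * 2 * K\<close> is just enough to
  get from deficit \<open>12 * c * K\<close> to \<open>6 * c * K\<close>.\<close>

lemma level_lower:
  assumes "real t / 2 ^ N < \<beta>" and "1 \<le> c"
  shows "m \<le> N \<Longrightarrow> 2 ^ N * \<alpha> - c * (2 ^ N * \<beta> - t) - 6 * real c * 2 ^ (N - m) \<le> level c a N m t"
proof (induction m)
  case 0
  have "real t \<le> 2 ^ N * \<beta>" using assms(1) by (simp add: field_simps)
  then have "0 \<le> c * (2 ^ N * \<beta> - t)" by simp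
  moreover have "2 ^ N * \<alpha> \<le> 2 ^ N * (6 * real c)"
    using alpha(2) assms(2) by (intro mult_left_mono) auto
  moreover have "2 ^ N * (6 * real c) = 6 * real c * 2 ^ (N - 0)" by simp
  ultimately show ?case unfolding level_simps by linarith
next
  case (Suc m)
  define K :: real where "K = 2 ^ (N - Suc m)"
  have K: "2 ^ (N - m) = 2 * K" using Suc.prems by (simp add: K_def Suc_diff_Suc flip: power_Suc)
  have "K \<ge> 0" by (simp add: K_def)
  then have "K * 1 \<le> K * c" using assms(2) by (intro mult_left_mono) auto
  then have "2 ^ N * \<alpha> - c * (2 ^ N * \<beta> - t) - 6 * real c * K \<le> sweep c a N m t"
    using sweep_lower[of m N t] Suc.prems assms(1) by (simp add: K algebra_simps)
  moreover have "2 ^ N * \<alpha> - c * (2 ^ N * \<beta> - t) - 6 * real c * K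
      \<le> real (level c a N m t + 3 * c * 2 ^ (N - m))"
    using Suc.IH Suc.prems by (simp add: K algebra_simps)
  ultimately show ?case
    unfolding level_simps climb_alt of_nat_max of_nat_min K_def by linarith
qed

end

section \<open>The limit profile\<close>

definition profile_at :: "nat \<Rightarrow> (nat \<Rightarrow> nat \<Rightarrow> nat) \<Rightarrow> nat \<Rightarrow> real \<Rightarrow> real" where
  "profile_at c a N x = height c a N (nat \<lfloor>2 ^ N * x\<rfloor>) / 2 ^ N"

definition profile :: "nat \<Rightarrow> (nat \<Rightarrow> nat \<Rightarrow> nat) \<Rightarrow> real \<Rightarrow> real" where
  "profile c a x = lim (\<lambda>N. profile_at c a N x)"

lemma floor_double_div: "nat \<lfloor>2 * y\<rfloor> div 2 = nat \<lfloor>y\<rfloor>" for y :: real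
proof -
  have "\<lfloor>2 * y\<rfloor> div 2 = \<lfloor>y\<rfloor>" by linarith
  then show ?thesis by (simp add: nat_div_distrib')
qed

lemma profile_at_Suc:
  "profile_at c a N x \<le> profile_at c a (Suc N) x"
  "profile_at c a (Suc N) x \<le> profile_at c a N x + 4 * real c / 2 ^ N"
proof -
  let ?t = "nat \<lfloor>2 ^ N * x\<rfloor>" and ?t' = "nat \<lfloor>2 ^ Suc N * x\<rfloor>"
  have "?t' div 2 = ?t" using floor_double_div[of "2 ^ N * x"] by (simp add: mult.assoc)
  from height_refine[OF this, of c a]
  have "real (2 * height c a N ?t) \<le> height c a (Suc N) ?t'"
    "real (height c a (Suc N) ?t') \<le> real (2 * height c a N ?t + 7 * c)"
    by (simp_all only: of_nat_le_iff)
  from this[THEN divide_right_mono, of "2 ^ Suc N"]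
  have "real (2 * height c a N ?t) / 2 ^ Suc N \<le> height c a (Suc N) ?t' / 2 ^ Suc N"
    "height c a (Suc N) ?t' / 2 ^ Suc N \<le> real (2 * height c a N ?t + 7 * c) / 2 ^ Suc N"
    by simp_all
  \<comment> \<open>The increment \<open>7 * c / 2 ^ Suc N\<close> is rounded up to
    \<open>4 * c / 2 ^ N\<close>.\<close>
  moreover have "real (2 * height c a N ?t + 7 * c) / 2 ^ Suc N
      \<le> profile_at c a N x + 4 * real c / 2 ^ N"
    by (simp add: profile_at_def field_simps)
  moreover have "real (2 * height c a N ?t) / 2 ^ Suc N = profile_at c a N x"
    by (simp add: profile_at_def)
  ultimately have "profile_at c a N x \<le> profile_at c a (Suc N) x
      \<and> profile_at c a (Suc N) x \<le> profile_at c a N x + 4 * real c / 2 ^ N"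
    unfolding profile_at_def[of c a "Suc N"] by linarith
  then show "profile_at c a N x \<le> profile_at c a (Suc N) x"
    and "profile_at c a (Suc N) x \<le> profile_at c a N x + 4 * real c / 2 ^ N" by simp_all
qed

text \<open>Sums the geometric increments; the subtracted term carries the induction.\<close>

lemma profile_at_le:
  assumes "N \<le> M"
  shows "profile_at c a M x \<le> profile_at c a N x + 8 * real c / 2 ^ N - 8 * real c / 2 ^ M"
  using assms
proof (induction rule: dec_induct)
  case (step M)
  have "8 * real c / 2 ^ M = 4 * real c / 2 ^ M + 8 * real c / 2 ^ Suc M" by (simp add: field_simps)
  then show ?case using step.IH profile_at_Suc(2)[of c a M x] by linarith
qed simp

text \<open>A bounded monotone sequence, with a rate independent of \<open>x\<close> and of the
  samples. Hence the limit is as good at and beyond \<beta> as before it.\<close>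

lemma profile_limit: "(\<lambda>N. profile_at c a N x) \<longlonglongrightarrow> profile c a x"
  and profile_bounds: "profile_at c a N x \<le> profile c a x"
    "profile c a x \<le> profile_at c a N x + 8 * real c / 2 ^ N"
proof -
  have inc: "incseq (\<lambda>N. profile_at c a N x)"
    by (rule incseq_SucI) (rule profile_at_Suc)
  have le: "profile_at c a M x \<le> profile_at c a N x + 8 * real c / 2 ^ N" if "N \<le> M" for M N
    using profile_at_le[OF that, of c a x] by (rule order_trans) simp
  obtain L where L: "(\<lambda>N. profile_at c a N x) \<longlonglongrightarrow> L"
  proof (rule incseq_convergent[OF inc])
    show "\<forall>M. profile_at c a M x \<le> profile_at c a 0 x + 8 * real c / 2 ^ 0"
      using le[OF le0] by blast
  qed
  then have eq: "profile c a x = L" unfolding profile_def by (rule limI)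
  show lim: "(\<lambda>N. profile_at c a N x) \<longlonglongrightarrow> profile c a x" using L eq by simp
  show "profile_at c a N x \<le> profile c a x" using inc lim by (rule incseq_le)
  show "profile c a x \<le> profile_at c a N x + 8 * real c / 2 ^ N"
    by (rule LIMSEQ_le_const2[OF lim]) (use le in blast)
qed

lemma profile_nonneg: "0 \<le> profile c a x"
  by (rule order_trans[OF _ profile_bounds(1)[where N = 0]]) (simp add: profile_at_def)

lemma divide_power2_tendsto_0: "(\<lambda>N. C / 2 ^ N) \<longlonglongrightarrow> 0" for C :: real
  using LIMSEQ_divide_realpow_zero[of 2 C] by simp

text \<open>Passes the grid bounds to the limit; rounding \<open>x\<close> and \<open>y\<close> to
  the grid costs at most one step, hence the vanishing term \<open>c / 2 ^ N\<close>.\<close>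

lemma profile_increment:
  assumes "0 \<le> x" and "x \<le> y"
  shows "profile c a x \<le> profile c a y" "profile c a y \<le> profile c a x + c * (y - x)"
proof -
  have *: "profile_at c a N x \<le> profile_at c a N y \<and>
      profile_at c a N y \<le> profile_at c a N x + c * (y - x) + c / 2 ^ N" for N
  proof -
    let ?s = "nat \<lfloor>2 ^ N * x\<rfloor>" and ?t = "nat \<lfloor>2 ^ N * y\<rfloor>"
    have "2 ^ N * x \<le> 2 ^ N * y" using assms(2) by simp
    then have st: "?s \<le> ?t" by (intro nat_mono floor_mono)
    have "0 \<le> 2 ^ N * x" "0 \<le> 2 ^ N * y" using assms by simp_all
    then have "real (?t - ?s) \<le> 2 ^ N * y - 2 ^ N * x + 1"
      using st by (simp add: of_nat_diff) linarith
    then have "real c * real (?t - ?s) \<le> c * (2 ^ N * y - 2 ^ N * x + 1)"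
      by (rule mult_left_mono) simp
    moreover have "real (height c a N ?t) \<le> real (height c a N ?s + c * (?t - ?s))"
      using height_bounds(2)[OF st] by (simp only: of_nat_le_iff)
    ultimately have "real (height c a N ?t)
        \<le> height c a N ?s + c * (2 ^ N * y - 2 ^ N * x + 1)"
      unfolding of_nat_add of_nat_mult by linarith
    then have "profile_at c a N y \<le> (height c a N ?s + c * (2 ^ N * y - 2 ^ N * x + 1)) / 2 ^ N"
      unfolding profile_at_def by (rule divide_right_mono) simp
    also have "\<dots> = profile_at c a N x + c * (y - x) + c / 2 ^ N"
      by (simp add: profile_at_def field_simps)
    finally show ?thesis
      using height_bounds(1)[OF st] by (simp add: profile_at_def divide_right_mono)
  qed
  show "profile c a x \<le> profile c a y"
    by (rule LIMSEQ_le[OF profile_limit profile_limit]) (use * in blast)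
  have "(\<lambda>N. profile_at c a N x + c * (y - x) + c / 2 ^ N) \<longlonglongrightarrow> profile c a x + c * (y - x) + 0"
    by (intro tendsto_add tendsto_const profile_limit divide_power2_tendsto_0)
  from LIMSEQ_le[OF profile_limit this] show "profile c a y \<le> profile c a x + c * (y - x)"
    using * by auto
qed

lemma profile_lipschitz:
  assumes "X \<subseteq> {0..}"
  shows "lipschitz_continuous_on X (profile c a)"
  unfolding lipschitz_continuous_on_def
proof (intro exI lipschitz_onI)
  show "dist (profile c a x) (profile c a y) \<le> real c * dist x y" if "x \<in> X" "y \<in> X" for x y
  proof (cases "x \<le> y")
    case True
    then show ?thesis
      using profile_increment[of x y c a] that assms by (auto simp: dist_real_def)
  next
    case False
    then show ?thesis
      using profile_increment[of y x c a] that assms by (auto simp: dist_real_def)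
  qed
qed simp

lemma profile_between:
  assumes upper: "\<And>n j. real j / 2 ^ n < \<beta> \<Longrightarrow> real (a n j) \<le> 2 ^ n * \<alpha>"
    and lower: "\<And>n j. real j / 2 ^ n < \<beta> \<Longrightarrow> 2 ^ n * \<alpha> - c * (2 ^ n * \<beta> - j) - 1 \<le> a n j"
    and alpha: "0 \<le> \<alpha>" "\<alpha> \<le> 1" "\<alpha> \<le> c * \<beta>" and c: "1 \<le> c"
    and x: "0 \<le> x" "x < \<beta>"
  shows "profile c a x \<le> \<alpha>" "\<alpha> - c * (\<beta> - x) \<le> profile c a x"
proof -
  \<comment> \<open>Of the error \<open>7 * c\<close>, the part \<open>6 * c\<close> is the deficit
    left after all \<open>N\<close> curves and \<open>c\<close> comes from rounding \<open>x\<close>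
    down to the grid.\<close>
  have *: "profile_at c a N x \<le> \<alpha> \<and> \<alpha> - c * (\<beta> - x) - 7 * real c / 2 ^ N \<le> profile_at c a N x" for N
  proof -
    let ?t = "nat \<lfloor>2 ^ N * x\<rfloor>"
    have "0 \<le> 2 ^ N * x" using x by simp
    then have t: "real ?t \<le> 2 ^ N * x" "2 ^ N * x - 1 \<le> real ?t" by linarith+
    then have "real ?t / 2 ^ N \<le> x" by (simp add: pos_divide_le_eq mult.commute)
    then have "real ?t / 2 ^ N < \<beta>" using x(2) by (rule le_less_trans)
    note t_bounds = level_upper[of \<beta> a \<alpha> c, OF upper lower alpha this order_refl]
      level_lower[of \<beta> a \<alpha> c, OF upper lower alpha this c order_refl]
    have "c * (2 ^ N * x - 1) \<le> c * real ?t" using t(2) by (rule mult_left_mono) simp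
    then have "2 ^ N * (\<alpha> - c * (\<beta> - x)) - 7 * real c \<le> height c a N ?t"
      using t_bounds(2) unfolding height_def by (simp add: algebra_simps)
    then have "(2 ^ N * (\<alpha> - c * (\<beta> - x)) - 7 * real c) / 2 ^ N \<le> profile_at c a N x"
      unfolding profile_at_def by (rule divide_right_mono) simp
    then have "\<alpha> - c * (\<beta> - x) - 7 * real c / 2 ^ N \<le> profile_at c a N x"
      by (simp add: diff_divide_distrib)
    moreover have "profile_at c a N x \<le> \<alpha>"
      using t_bounds(1) by (simp add: profile_at_def height_def field_simps)
    ultimately show ?thesis by simp
  qed
  show "profile c a x \<le> \<alpha>"
    by (rule LIMSEQ_le_const2[OF profile_limit]) (use * in blast)
  have "(\<lambda>N. \<alpha> - c * (\<beta> - x) - 7 * real c / 2 ^ N) \<longlonglongrightarrow> \<alpha> - c * (\<beta> - x) - 0"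
    by (intro tendsto_diff tendsto_const divide_power2_tendsto_0)
  from LIMSEQ_le[OF this profile_limit] show "\<alpha> - c * (\<beta> - x) \<le> profile c a x"
    using * by auto
qed

section \<open>Computability of the profile\<close>

text \<open>Rounding down keeps the sample below \<alpha> left of \<beta> and loses less than one
  unit, which the \<open>- 1\<close> in the lower bounds on \<open>a n j\<close> allows for.\<close>

definition sample :: "(rat \<Rightarrow> rat option) \<Rightarrow> nat \<Rightarrow> nat \<Rightarrow> nat" where
  "sample g n j = nat \<lfloor>2 ^ n * real_of_rat (the (g (of_nat j / 2 ^ n)))\<rfloor>"

lemma of_rat_dyadic: "real_of_rat (of_nat j / 2 ^ n) = real j / 2 ^ n"
  by (simp add: of_rat_divide of_rat_power)

text \<open>\<open>X\<close> will be \<open>{0..<\<beta>}\<close> in general and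
  \<open>{0..b}\<close> with \<open>b < 1\<close> for a total function. Downward closure fits
  because a height at \<open>x\<close> uses samples at points up to \<open>x\<close> only.\<close>

locale translation_program =
  fixes g :: "rat \<Rightarrow> rat option" and p :: prog and X :: "real set"
  assumes X: "X \<subseteq> {0..<1}" and X_down: "\<And>x y. x \<in> X \<Longrightarrow> 0 \<le> y \<Longrightarrow> y \<le> x \<Longrightarrow> y \<in> X"
    and p: "\<And>A q. real_of_rat q \<in> X \<Longrightarrow> evals A p [rat_code q] (rat_code (the (g q)))"
begin

lemma computes_sample:
  assumes "computes S A xs F" and "computes S A xs G"
    and "\<forall>s\<in>S. real (G s) / 2 ^ F s \<in> X"
  shows "computes S A xs (\<lambda>s. sample g (F s) (G s))"
proof -
  let ?q = "\<lambda>s. of_nat (G s) / 2 ^ F s :: rat"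
  have "frac_code (G s) (2 ^ F s) = rat_code (?q s)" for s
    by (simp add: frac_code_eq)
  moreover have "computes S A xs (\<lambda>s. frac_code (G s) (2 ^ F s))"
    by (intro computes_frac_code computes_power computes_const assms(1,2))
  ultimately have "computes S A xs (\<lambda>s. rat_code (?q s))" by simp
  moreover have "evals (A s) p [rat_code (?q s)] (rat_code (the (g (?q s))))" if "s \<in> S" for s
    using assms(3) that by (intro p) (simp add: of_rat_dyadic)
  ultimately have "computes S A xs (\<lambda>s. rat_code (the (g (?q s))))"
    by (rule computes_1[rotated])
  then have "computes S A xs (\<lambda>s. floor_code (F s) (rat_code (the (g (?q s)))))"
    by (intro computes_floor_code assms(1))
  then show ?thesis by (simp add: floor_code_rat_code sample_def)
qed

lemma cell_in_X:
  assumes "real t / 2 ^ N \<in> X" and "i < t" and "n \<le> N"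
  shows "real (i div 2 ^ (N - n)) / 2 ^ n \<in> X"
proof (rule X_down[OF assms(1)])
  have "real i / 2 ^ N \<le> real t / 2 ^ N" using assms(2) by (simp add: divide_right_mono)
  then show "real (i div 2 ^ (N - n)) / 2 ^ n \<le> real t / 2 ^ N"
    using cell_le[OF assms(3), of i] by linarith
qed simp

lemma height_program:
  obtains r where "\<And>A N t. real t / 2 ^ N \<in> X \<Longrightarrow> evals A r [N, t] (height c (sample g) N t)"
proof -
  have "computes {s. real (snd (snd s)) / 2 ^ fst (snd s) \<in> X} fst
      (\<lambda>s. [fst (snd s), snd (snd s)]) (\<lambda>s. height c (sample g) (fst (snd s)) (snd (snd s)))"
    \<comment> \<open>What remains is that all sampled points lie in \<open>X\<close>; the counter
      bounds recorded by \<open>computes_rec\<close> give this through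
      \<open>cell_in_X\<close>.\<close>
    unfolding height_def level_def sweep_def climb_def
    by (intro computes_intros computes_div computes_sample)
      (auto intro: cell_in_X)
  then obtain r where "\<forall>s\<in>{s. real (snd (snd s)) / 2 ^ fst (snd s) \<in> X}.
      evals (fst s) r [fst (snd s), snd (snd s)] (height c (sample g) (fst (snd s)) (snd (snd s)))"
    unfolding computes_def by blast
  then show thesis by (intro that[of r]) auto
qed

end

section \<open>Error bounds for effective approximations\<close>

lemma abs_of_rat_diff_less:
  "\<bar>real_of_rat a - real_of_rat b\<bar> < 1 / 2 ^ k \<longleftrightarrow> \<bar>a - b\<bar> < 1 / 2 ^ k"
proof -
  have "\<bar>real_of_rat a - real_of_rat b\<bar> = real_of_rat \<bar>a - b\<bar>"
    by (simp flip: of_rat_diff)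
  moreover have "(1 / 2 ^ k :: real) = real_of_rat (1 / 2 ^ k)"
    by (simp add: of_rat_divide of_rat_power)
  ultimately show ?thesis by (simp only: of_rat_less)
qed

lemma effective_approx_error:
  assumes "effective_approx q x"
  shows "\<bar>real_of_rat (q n) - x\<bar> \<le> 2 / 2 ^ n"
proof -
  have diff: "\<bar>real_of_rat (q k) - real_of_rat (q (Suc k))\<bar> < 1 / 2 ^ k" for k
    using assms by (simp add: abs_of_rat_diff_less effective_approx_def)
  have dist: "\<bar>real_of_rat (q n) - real_of_rat (q m)\<bar> \<le> 2 / 2 ^ n - 2 / 2 ^ m" if "n \<le> m" for m
    using that
  proof (induction rule: dec_induct)
    case (step k)
    have "2 / 2 ^ Suc k = (1 / 2 ^ k :: real)" "2 / 2 ^ k = (2 * (1 / 2 ^ k) :: real)" by simp_all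
    then show ?case using diff[of k] step.IH by linarith
  qed simp
  have le: "\<bar>real_of_rat (q n) - real_of_rat (q m)\<bar> \<le> 2 / 2 ^ n" if "n \<le> m" for m
    using dist[OF that] by (rule order_trans) simp
  have "(\<lambda>m. \<bar>real_of_rat (q n) - real_of_rat (q m)\<bar>) \<longlonglongrightarrow> \<bar>real_of_rat (q n) - x\<bar>"
    using assms by (intro tendsto_intros) (simp add: effective_approx_def)
  then show ?thesis by (rule LIMSEQ_le_const2) (use le in blast)
qed

text \<open>Two consecutive errors add up to \<open>3 * C / 2 ^ (n + e + 1)\<close>; the shift
  \<open>e\<close> brings this below \<open>1 / 2 ^ n\<close>.\<close>

lemma effective_approxI:
  assumes err: "\<And>n. \<bar>real_of_rat (r n) - x\<bar> \<le> C / 2 ^ (n + e)" and e: "3 * C < 2 * 2 ^ e"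
  shows "effective_approx r x"
  unfolding effective_approx_def
proof
  show "\<forall>n. \<bar>r n - r (Suc n)\<bar> < 1 / 2 ^ n"
  proof
    fix n
    have "C / 2 ^ (n + e) + C / 2 ^ (Suc n + e) = (3 * C) / (2 * 2 ^ e * 2 ^ n)"
      by (simp add: power_add field_simps)
    also have "\<dots> < (2 * 2 ^ e) / (2 * 2 ^ e * 2 ^ n)"
      by (rule divide_strict_right_mono[OF e]) simp
    also have "\<dots> = 1 / 2 ^ n" by simp
    finally have "\<bar>real_of_rat (r n) - real_of_rat (r (Suc n))\<bar> < 1 / 2 ^ n"
      using err[of n] err[of "Suc n"] by linarith
    then show "\<bar>r n - r (Suc n)\<bar> < 1 / 2 ^ n" by (simp only: abs_of_rat_diff_less)
  qed
  have "(\<lambda>n. C / 2 ^ (n + e)) \<longlonglongrightarrow> 0"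
    by (rule LIMSEQ_ignore_initial_segment[OF divide_power2_tendsto_0])
  then have "(\<lambda>n. real_of_rat (r n) - x) \<longlonglongrightarrow> 0"
    by (rule Lim_null_comparison[rotated]) (use err in simp)
  then show "(\<lambda>n. real_of_rat (r n)) \<longlonglongrightarrow> x" by (rule Lim_null[THEN iffD2])
qed

context translation_program
begin

lemma profile_computable: "computable_on X (profile c (sample g))"
proof -
  \<comment> \<open>With error constant \<open>10 * c\<close>, \<open>effective_approxI\<close> asks
    for \<open>15 * c < 2 ^ e\<close>, and \<open>e < 2 ^ e\<close>.\<close>
  define e where "e = 15 * c"
  obtain h where h: "\<And>A N t. real t / 2 ^ N \<in> X \<Longrightarrow> evals A h [N, t] (height c (sample g) N t)"
    using height_program by blast
  \<comment> \<open>The term \<open>q (N + 1)\<close> is within one grid unit of \<open>x\<close>.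
    Subtracting 1 after rounding puts the grid point at or left of \<open>x\<close>, so inside
    \<open>X\<close>, and at most two units below the rounded \<open>x\<close>; truncated
    subtraction stops it at 0.\<close>
  define pos :: "(nat \<Rightarrow> rat) \<Rightarrow> nat \<Rightarrow> nat" where
    "pos q N = nat \<lfloor>2 ^ N * real_of_rat (q (N + 1))\<rfloor> - 1" for q N
  define out :: "(nat \<Rightarrow> rat) \<Rightarrow> nat \<Rightarrow> rat" where
    "out q n = of_nat (height c (sample g) (n + e) (pos q (n + e))) / 2 ^ (n + e)" for q n
  have pos: "real (pos q N) \<le> 2 ^ N * x" "nat \<lfloor>2 ^ N * x\<rfloor> \<le> pos q N + 2"
    if "x \<in> X" "effective_approx q x" for x q N
  proof -
    have "x \<ge> 0" using that(1) X by auto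
    then have x0: "0 \<le> 2 ^ N * x" by simp
    have "\<bar>real_of_rat (q (N + 1)) - x\<bar> \<le> 1 / 2 ^ N"
      using effective_approx_error[OF that(2), of "N + 1"] by simp
    then have "2 ^ N * \<bar>real_of_rat (q (N + 1)) - x\<bar> \<le> 1" by (simp add: field_simps)
    then have "\<bar>2 ^ N * real_of_rat (q (N + 1)) - 2 ^ N * x\<bar> \<le> 1"
      by (simp add: abs_mult flip: right_diff_distrib)
    then show "real (pos q N) \<le> 2 ^ N * x" "nat \<lfloor>2 ^ N * x\<rfloor> \<le> pos q N + 2"
      unfolding pos_def using x0 by linarith+
  qed
  have pos_X: "real (pos q N) / 2 ^ N \<in> X" if "x \<in> X" "effective_approx q x" for x q N
    using pos(1)[OF that, of N] by (intro X_down[OF that(1)]) (simp_all add: field_simps)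
  have out: "effective_approx (out q) (profile c (sample g) x)"
    if "x \<in> X" "effective_approx q x" for x q
  proof (rule effective_approxI)
    show "3 * (10 * real c) < 2 * 2 ^ e"
    proof -
      have "real e < 2 ^ e" by (rule of_nat_less_two_power)
      then show ?thesis by (simp add: e_def)
    qed
    \<comment> \<open>Error \<open>2 * c\<close> for the position, two units off at slope
      \<open>c\<close>, and \<open>8 * c\<close> for the distance to the limit.\<close>
    fix n
    let ?N = "n + e"
    let ?t = "nat \<lfloor>2 ^ ?N * x\<rfloor>"
    have "pos q ?N \<le> ?t" using pos(1)[OF that, of ?N] by linarith
    note b = height_bounds[OF this, of c "sample g" ?N]
    have "c * (?t - pos q ?N) \<le> c * 2"
      using pos(2)[OF that, of ?N] by (intro mult_le_mono2) linarith
    with b have "real (height c (sample g) ?N ?t)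
        \<le> real (height c (sample g) ?N (pos q ?N) + 2 * c)"
      by (intro of_nat_mono) linarith
    then have "profile_at c (sample g) ?N x
        \<le> real (height c (sample g) ?N (pos q ?N) + 2 * c) / 2 ^ ?N"
      unfolding profile_at_def by (rule divide_right_mono) simp
    also have "\<dots> = real_of_rat (out q n) + 2 * real c / 2 ^ ?N"
      unfolding out_def of_rat_dyadic by (simp add: add_divide_distrib)
    finally have "profile_at c (sample g) ?N x \<le> real_of_rat (out q n) + 2 * real c / 2 ^ ?N" .
    moreover have "real_of_rat (out q n) \<le> profile_at c (sample g) ?N x"
      unfolding out_def of_rat_dyadic profile_at_def
      using b(1) by (intro divide_right_mono) simp_all
    moreover have "10 * real c / 2 ^ ?N = 2 * real c / 2 ^ ?N + 8 * real c / 2 ^ ?N"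
      by (simp flip: add_divide_distrib)
    moreover have "0 \<le> 8 * real c / 2 ^ ?N" by simp
    ultimately show "\<bar>real_of_rat (out q n) - profile c (sample g) x\<bar> \<le> 10 * real c / 2 ^ ?N"
      using profile_bounds(1)[of c "sample g" ?N x] profile_bounds(2)[of c "sample g" x ?N]
      by linarith
  qed
  \<comment> \<open>A state is a pair of an approximating sequence, serving as oracle, and a
    precision \<open>n\<close>.\<close>
  let ?S = "{s. \<exists>x\<in>X. effective_approx (fst s) x}"
  let ?A = "\<lambda>s k. rat_code (fst s k)" and ?xs = "\<lambda>s. [snd s]"
  let ?N = "\<lambda>s. snd s + e"
  have "computes ?S ?A ?xs (\<lambda>s. floor_code (?N s) (?A s (?N s + 1)) - 1)"
    by (intro computes_minus computes_floor_code computes_query computes_plus computes_arg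
      computes_const)
  then have pos_comp: "computes ?S ?A ?xs (\<lambda>s. pos (fst s) (?N s))"
    by (simp add: floor_code_rat_code pos_def)
  have height_comp: "computes ?S ?A ?xs (\<lambda>s. height c (sample g) (?N s) (pos (fst s) (?N s)))"
  proof (rule computes_comp)
    show "evals (?A s) h (map (\<lambda>G. G s) [?N, \<lambda>s. pos (fst s) (?N s)])
        (height c (sample g) (?N s) (pos (fst s) (?N s)))" if "s \<in> ?S" for s
    proof -
      from that obtain x where "x \<in> X" "effective_approx (fst s) x" by blast
      then have "real (pos (fst s) (?N s)) / 2 ^ ?N s \<in> X" by (rule pos_X)
      then show ?thesis by (simp add: h)
    qed
    have "computes ?S ?A ?xs ?N" by (intro computes_plus computes_arg computes_const)
    then show "computes ?S ?A ?xs G" if "G \<in> set [?N, \<lambda>s. pos (fst s) (?N s)]" for G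
      using that pos_comp by auto
  qed
  have "computes ?S ?A ?xs
      (\<lambda>s. frac_code (height c (sample g) (?N s) (pos (fst s) (?N s))) (2 ^ ?N s))"
    by (intro computes_frac_code height_comp computes_power computes_plus computes_arg
      computes_const)
  then have "computes ?S ?A ?xs (\<lambda>s. rat_code (out (fst s) (snd s)))"
    by (simp add: frac_code_eq out_def)
  then obtain r where r: "\<forall>s\<in>?S. evals (?A s) r (?xs s) (rat_code (out (fst s) (snd s)))"
    unfolding computes_def ..
  show ?thesis
    unfolding computable_on_def
  proof (intro exI[of _ r] ballI allI impI)
    fix x q
    assume x: "x \<in> X" "effective_approx q x"
    have "evals (\<lambda>k. rat_code (q k)) r [n] (rat_code (out q n))" for n
      using r[rule_format, of "(q, n)"] x by auto
    then show "\<exists>r'. effective_approx r' (profile c (sample g) x) \<and>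
        (\<forall>n. evals (\<lambda>k. rat_code (q k)) r [n] (rat_code (r' n)))"
      using out[OF x] by blast
  qed
qed

end

section \<open>Solovay reducibility\<close>

lemma translation_programI:
  assumes "partial_computable g" and X: "X \<subseteq> {0..<1}"
    and down: "\<And>x y. x \<in> X \<Longrightarrow> 0 \<le> y \<Longrightarrow> y \<le> x \<Longrightarrow> y \<in> X"
    and def: "\<And>q. real_of_rat q \<in> X \<Longrightarrow> g q \<noteq> None"
  shows "\<exists>p. translation_program g p X"
proof -
  obtain p where p: "\<And>q v. q \<in> {0..<1} \<Longrightarrow>
      evals no_oracle p [rat_code q] v \<longleftrightarrow> (\<exists>r. g q = Some r \<and> v = rat_code r)"
    using assms(1) unfolding partial_computable_def by blast
  have "translation_program g (fix_query 0 p) X"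
  proof
    fix A :: "nat \<Rightarrow> nat" and q :: rat
    assume q: "real_of_rat q \<in> X"
    with X have "q \<in> {0..<1}" by auto
    moreover have "g q = Some (the (g q))" using def[OF q] by simp
    ultimately have "evals no_oracle p [rat_code q] (rat_code (the (g q)))" using p by blast
    then show "evals A (fix_query 0 p) [rat_code q] (rat_code (the (g q)))"
      by (rule evals_fix_query)
  qed (use X down in auto)
  then show ?thesis ..
qed

lemma rat_translation_pos:
  assumes "rat_translation \<beta> \<alpha> g" and "0 \<le> \<beta>"
  shows "0 < \<beta>"
proof (rule ccontr)
  assume "\<not> 0 < \<beta>"
  then have "left_cut \<beta> = {}" using assms(2) by (auto simp: left_cut_def)
  then have "left_rats \<beta> = bot" by (simp add: left_rats_def)
  then show False using assms(1) by (simp add: rat_translation_def has_limit_def)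
qed

text \<open>A rational is approximated by its constant sequence, and that constant oracle can be
  hardwired by \<open>fix_query\<close>.\<close>

lemma computable_real_of_computable_on:
  assumes "computable_on X f" and "real_of_rat q \<in> X"
  shows "computable_real (f (real_of_rat q))"
proof -
  obtain p where p: "\<And>x q. x \<in> X \<Longrightarrow> effective_approx q x \<Longrightarrow> \<exists>r. effective_approx r (f x) \<and>
      (\<forall>n. evals (\<lambda>k. rat_code (q k)) p [n] (rat_code (r n)))"
    using assms(1) unfolding computable_on_def by blast
  have "effective_approx (\<lambda>_. q) (real_of_rat q)" by (simp add: effective_approx_def)
  from p[OF assms(2) this] obtain r where r: "effective_approx r (f (real_of_rat q))"
    and "\<And>n. evals (\<lambda>_. rat_code q) p [n] (rat_code (r n))" by blast
  then have "\<And>n. evals no_oracle (fix_query (rat_code q) p) [n] (rat_code (r n))"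
    by (blast intro: evals_fix_query)
  with r show ?thesis unfolding computable_real_def by blast
qed

lemma solovay_profile:
  assumes via: "solovay_via g \<alpha> \<beta>" and \<alpha>: "\<alpha> \<in> {0..<1}" and \<beta>: "\<beta> \<in> {0..<1}"
  obtains c where
    "\<And>x. 0 \<le> x \<Longrightarrow> x < \<beta> \<Longrightarrow> profile c (sample g) x \<le> \<alpha>"
    "\<And>x. 0 \<le> x \<Longrightarrow> x < \<beta> \<Longrightarrow> \<alpha> - c * (\<beta> - x) \<le> profile c (sample g) x"
proof -
  from via have trans: "rat_translation \<beta> \<alpha> g" by (simp add: solovay_via_def)
  have "\<beta> > 0" using rat_translation_pos[OF trans] \<beta> by simp
  obtain C :: real where C: "\<And>q. q \<in> left_cut \<beta> \<Longrightarrow> \<alpha> - real_of_rat (the (g q)) < C * (\<beta> - real_of_rat q)"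
    using via unfolding solovay_via_def by blast
  \<comment> \<open>The three demands: \<open>1 \<le> c\<close> for \<open>level_lower\<close>,
    \<open>C \<le> c\<close> for the Solovay bound, and \<open>1 / \<beta> \<le> c\<close> for
    \<open>\<alpha> \<le> c * \<beta>\<close>.\<close>
  obtain c :: nat where c: "max 1 (max C (1 / \<beta>)) \<le> real c" using real_arch_simple by blast
  then have c1: "1 \<le> c" and cC: "C \<le> real c" and "1 / \<beta> \<le> real c" by simp_all
  then have "1 \<le> c * \<beta>" using \<open>\<beta> > 0\<close> by (simp add: field_simps)
  then have \<alpha>_le: "0 \<le> \<alpha>" "\<alpha> \<le> 1" "\<alpha> \<le> c * \<beta>" using \<alpha> by auto
  have *: "real (sample g n j) \<le> 2 ^ n * \<alpha> \<and>
      2 ^ n * \<alpha> - c * (2 ^ n * \<beta> - j) - 1 \<le> sample g n j" if "real j / 2 ^ n < \<beta>" for n j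
  proof -
    let ?q = "of_nat j / 2 ^ n :: rat"
    let ?r = "real_of_rat (the (g ?q))"
    have q: "?q \<in> left_cut \<beta>" using that by (simp add: left_cut_def of_rat_dyadic)
    then obtain r where r: "g ?q = Some r" "real_of_rat r < \<alpha>"
      using trans unfolding rat_translation_def by blast
    then have "r \<in> {0..<1}"
      using trans unfolding rat_translation_def partial_computable_def by (auto intro: ranI)
    then have r0: "0 \<le> 2 ^ n * ?r" using r(1) by simp
    have upper: "2 ^ n * ?r \<le> 2 ^ n * \<alpha>" using r by simp
    have "\<alpha> - ?r \<le> c * (\<beta> - real j / 2 ^ n)"
      using C[OF q] mult_right_mono[OF cC, of "\<beta> - real j / 2 ^ n"] that
      unfolding of_rat_dyadic by linarith
    then have "2 ^ n * (\<alpha> - ?r) \<le> 2 ^ n * (c * (\<beta> - real j / 2 ^ n))"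
      by (rule mult_left_mono) simp
    also have "\<dots> = c * (2 ^ n * \<beta> - j)" by (simp add: field_simps)
    finally have "2 ^ n * \<alpha> - 2 ^ n * ?r \<le> c * (2 ^ n * \<beta> - j)"
      by (simp add: right_diff_distrib)
    with upper r0 show ?thesis unfolding sample_def by linarith
  qed
  show thesis
    using profile_between[of \<beta> "sample g" \<alpha> c, OF _ _ \<alpha>_le c1] * by (intro that[of c]) auto
qed

lemma profile_tendsto_left:
  fixes \<alpha> \<beta> c :: real
  assumes "0 < \<beta>"
    and "\<And>x. 0 \<le> x \<Longrightarrow> x < \<beta> \<Longrightarrow> f x \<le> \<alpha>"
    and "\<And>x. 0 \<le> x \<Longrightarrow> x < \<beta> \<Longrightarrow> \<alpha> - c * (\<beta> - x) \<le> f x"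
  shows "has_limit f \<alpha> (at \<beta> within {0..<\<beta>})"
  unfolding has_limit_def
proof
  show "at \<beta> within {0..<\<beta>} \<noteq> bot"
    using assms(1) by (simp add: at_within_eq_bot_iff)
  have "((\<lambda>x. \<alpha> - c * (\<beta> - x)) \<longlongrightarrow> \<alpha> - c * (\<beta> - \<beta>)) (at \<beta> within {0..<\<beta>})"
    by (intro tendsto_intros)
  then have lim: "((\<lambda>x. \<alpha> - c * (\<beta> - x)) \<longlongrightarrow> \<alpha>) (at \<beta> within {0..<\<beta>})" by simp
  show "(f \<longlongrightarrow> \<alpha>) (at \<beta> within {0..<\<beta>})"
  proof (rule tendsto_sandwich[OF _ _ lim tendsto_const])
    have in_dom: "\<forall>\<^sub>F x in at \<beta> within {0..<\<beta>}. 0 \<le> x \<and> x < \<beta>"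
      by (simp add: eventually_at_filter)
    show "\<forall>\<^sub>F x in at \<beta> within {0..<\<beta>}. \<alpha> - c * (\<beta> - x) \<le> f x"
      using in_dom by eventually_elim (use assms(3) in blast)
    show "\<forall>\<^sub>F x in at \<beta> within {0..<\<beta>}. f x \<le> \<alpha>"
      using in_dom by eventually_elim (use assms(2) in blast)
  qed
qed

lemma solovay_reductions:
  assumes via: "solovay_via g \<alpha> \<beta>" and \<alpha>: "\<alpha> \<in> {0..<1}" and \<beta>: "\<beta> \<in> {0..<1}"
  shows "\<alpha> \<le>\<^sub>c\<^sub>l\<^sup>o\<^sup>p\<^sup>e\<^sup>n \<beta>"
    and "dom g = {0..<1} \<Longrightarrow> \<alpha> \<le>\<^sub>c\<^sub>l\<^sup>l\<^sup>o\<^sup>c\<^sup>a\<^sup>l \<beta>"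
    and "\<not> computable_real \<alpha> \<Longrightarrow> \<alpha> \<le>\<^sub>S\<^sup>\<real> \<beta>"
proof -
  from via have trans: "rat_translation \<beta> \<alpha> g" by (simp add: solovay_via_def)
  then have pc: "partial_computable g" by (simp add: rat_translation_def)
  have "\<beta> > 0" using rat_translation_pos[OF trans] \<beta> by simp
  obtain c where c: "\<And>x. 0 \<le> x \<Longrightarrow> x < \<beta> \<Longrightarrow> profile c (sample g) x \<le> \<alpha>"
    "\<And>x. 0 \<le> x \<Longrightarrow> x < \<beta> \<Longrightarrow> \<alpha> - c * (\<beta> - x) \<le> profile c (sample g) x"
    using solovay_profile[OF assms] by blast
  let ?f = "profile c (sample g)"
  have limit: "has_limit ?f \<alpha> (at \<beta> within {0..<\<beta>})"
    by (rule profile_tendsto_left[OF \<open>\<beta> > 0\<close> c])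
  have "\<exists>p. translation_program g p {0..<\<beta>}"
    using \<beta> trans
    by (intro translation_programI[OF pc]) (auto simp: rat_translation_def left_cut_def)
  then have comp: "computable_on {0..<\<beta>} ?f"
    using translation_program.profile_computable by blast
  have lip: "lipschitz_continuous_on X ?f" if "X \<subseteq> {0..}" for X
    using that by (rule profile_lipschitz)
  have lip_\<beta>: "lipschitz_continuous_on {0..<\<beta>} ?f" by (rule lip) auto
  show "\<alpha> \<le>\<^sub>c\<^sub>l\<^sup>o\<^sup>p\<^sup>e\<^sup>n \<beta>"
    unfolding cl_open_le_def weakly_real_translation_def
    using limit comp lip_\<beta> by blast
  show "\<alpha> \<le>\<^sub>c\<^sub>l\<^sup>l\<^sup>o\<^sup>c\<^sup>a\<^sup>l \<beta>" if dom: "dom g = {0..<1}"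
  proof -
    \<comment> \<open>Any point strictly between \<beta> and 1 works: a total \<open>g\<close> is
      defined at all rationals of \<open>{0..b}\<close>.\<close>
    define b where "b = (1 + \<beta>) / 2"
    have b: "\<beta> < b" "b < 1" using \<beta> by (auto simp: b_def)
    have "\<exists>p. translation_program g p {0..b}"
    proof (rule translation_programI[OF pc])
      fix q assume "real_of_rat q \<in> {0..b}"
      then have "0 \<le> real_of_rat q" "real_of_rat q \<le> b" by simp_all
      moreover from this have "real_of_rat q < 1" using b(2) by linarith
      ultimately have "q \<in> dom g" unfolding dom by simp
      then show "g q \<noteq> None" by auto
    qed (use b in auto)
    then have "computable_on {0..b} ?f"
      using translation_program.profile_computable by blast
    moreover have lip_b: "lipschitz_continuous_on {0..b} ?f" by (rule lip) auto
    \<comment> \<open>The value at \<beta> is determined by the left limit, because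
      \<open>?f\<close> is continuous on \<open>{0..b}\<close>.\<close>
    moreover have "?f \<beta> = \<alpha>"
    proof -
      have "continuous_on {0..b} ?f"
        using lip_b lipschitz_on_continuous_on unfolding lipschitz_continuous_on_def by blast
      then have "(?f \<longlongrightarrow> ?f \<beta>) (at \<beta> within {0..b})"
        using b \<beta> by (simp add: continuous_on_def)
      then have "(?f \<longlongrightarrow> ?f \<beta>) (at \<beta> within {0..<\<beta>})"
        by (rule tendsto_within_subset) (use b in auto)
      then show ?thesis
        using limit tendsto_unique unfolding has_limit_def by blast
    qed
    ultimately show ?thesis unfolding cl_local_le_def using b(1) by blast
  qed
  show "\<alpha> \<le>\<^sub>S\<^sup>\<real> \<beta>" if nc: "\<not> computable_real \<alpha>"
  proof -
    have "?f x < \<alpha>" if x: "0 \<le> x" "x < \<beta>" for x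
    proof (rule ccontr)
      assume "\<not> ?f x < \<alpha>"
      \<comment> \<open>Monotonicity carries the value \<alpha> from \<open>x\<close> to any
        rational between \<open>x\<close> and \<beta>, since \<open>?f\<close> stays at most
        \<alpha> there.\<close>
      obtain q where q: "x < real_of_rat q" "real_of_rat q < \<beta>"
        using of_rat_dense[OF x(2)] by blast
      have "0 \<le> real_of_rat q" using q(1) x(1) by linarith
      then have q_in: "real_of_rat q \<in> {0..<\<beta>}" using q(2) by (simp only: atLeastLessThan_iff)
      have "?f x \<le> ?f (real_of_rat q)" using q(1) x(1) by (intro profile_increment) simp_all
      moreover have "?f (real_of_rat q) \<le> \<alpha>"
        by (rule c(1)) (use q_in in \<open>simp_all only: atLeastLessThan_iff\<close>)
      ultimately have "?f (real_of_rat q) = \<alpha>" using \<open>\<not> ?f x < \<alpha>\<close> by linarith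
      moreover have "computable_real (?f (real_of_rat q))"
        by (rule computable_real_of_computable_on[OF comp q_in])
      ultimately show False using nc by simp
    qed
    then have "?f ` {0..<\<beta>} \<subseteq> {0..<\<alpha>}" using profile_nonneg by auto
    then show ?thesis
      unfolding real_solovay_le_def real_translation_def
      using limit comp lip_\<beta> by blast
  qed
qed

theorem theorem1:
  fixes \<alpha> \<beta> :: real
  assumes "\<alpha> \<in> {0..<1}" and "\<beta> \<in> {0..<1}"
  shows "(\<alpha> \<le>\<^sub>S \<beta> \<longrightarrow> \<alpha> \<le>\<^sub>c\<^sub>l\<^sup>o\<^sup>p\<^sup>e\<^sup>n \<beta>) \<and>
         (\<alpha> \<le>\<^sub>S\<^sup>t\<^sup>o\<^sup>t \<beta> \<longrightarrow> \<alpha> \<le>\<^sub>c\<^sub>l\<^sup>l\<^sup>o\<^sup>c\<^sup>a\<^sup>l \<beta>) \<and>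
         (\<not> computable_real \<alpha> \<longrightarrow> \<alpha> \<le>\<^sub>S \<beta> \<longrightarrow> \<alpha> \<le>\<^sub>S\<^sup>\<real> \<beta>)"
  using solovay_reductions[OF _ assms] unfolding solovay_le_def total_solovay_le_def by blast

end
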